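(* For every partition $\lambda$, the map $\mathtt{uncrowd}$ is a bijection from $\mathsf{S}(\lambda)$ to $\mathsf{L}(\lambda)$.
   Context: Young diagrams are in English notation, with rows numbered $1,2,\dots$ from top to bottom. $\mathsf{S}(\lambda)$ is the set of semistandard set-valued tableaux of shape $\lambda$: fillings of the Young diagram of $\lambda$ by nonempty finite sets of positive integers such that $\max A\le\min B$ whenever $B$ is immediately to the right of $A$, and $\max A<\min B$ whenever $B$ is immediately below $A$. $\mathsf{L}(\lambda)$ is the set of pairs $(T,U)$ such that, for some partition $\mu\supseteq\lambda$, $T$ is a filling of the skew shape $\mu/\lambda$ by integers that is row and column strict (strictly increasing from left to right along rows and from top to bottom along columns), with every entry of row $i$ between $1$ and $i-1$, and $U$ is an (ordinary) semistandard Young tableau of shape $\mu$ (rows weakly increasing, columns strictly increasing, positive integer entries). Definition of $\mathtt{uncrowd}$. Given $F\in\mathsf{S}(\lambda)$, start with $T$ the empty filling of $\lambda/\lambda$ and $U=F$. Read the boxes of $U$ row by row from the bottom row to the top row, and within each row from right to left. While the current box, in row $i$ say, contains more than one number, remove the largest number from that box and RSK-insert it (row insertion) into $U$ starting from row $i+1$. Here row insertion of $x$ into a row means: if no entry of the row is greater than $x$, append $x$ in a new box at the end of the row (creating a new row if the row is empty); otherwise replace the leftmost entry $y>x$ of the row by $x$ and insert $y$ into the next row down. Each such step adds exactly one new box to the shape of $U$, in some row $k$; add the corresponding box to $T$, with entry $k-i$. When all boxes have been processed (so every box of $U$ has exactly one entry), set $\mathtt{uncrowd}(F)=(T,U)$.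 *)

theory Defs
  imports Main "HOL-Library.While_Combinator"
begin

text \<open>
  Rows and columns are indexed from 0: list row \<open>r\<close> is the row numbered \<open>r + 1\<close> in the usual
  convention.  A filling of a straight shape is the list of its rows, from top to bottom;
  a filling of a skew shape is a partial map on boxes whose domain is the set of boxes of the shape.
\<close>

definition is_partition :: "nat list \<Rightarrow> bool" where
  "is_partition lam \<longleftrightarrow> sorted_wrt (\<ge>) lam \<and> (\<forall>p\<in>set lam. 0 < p)"

definition diagram :: "nat list \<Rightarrow> (nat \<times> nat) set" where
  "diagram lam = {(r, c). r < length lam \<and> c < lam ! r}"

definition shape :: "'a list list \<Rightarrow> nat list" where
  "shape F = map length F"

definition set_valued_tableaux :: "nat list \<Rightarrow> nat set list list set" where
  "set_valued_tableaux lam = {F. shape F = lam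
     \<and> (\<forall>(r, c)\<in>diagram lam. finite (F ! r ! c) \<and> F ! r ! c \<noteq> {} \<and> (\<forall>x\<in>F ! r ! c. 0 < x))
     \<and> (\<forall>r c. (r, c) \<in> diagram lam \<and> (r, Suc c) \<in> diagram lam \<longrightarrow>
          Max (F ! r ! c) \<le> Min (F ! r ! Suc c))
     \<and> (\<forall>r c. (r, c) \<in> diagram lam \<and> (Suc r, c) \<in> diagram lam \<longrightarrow>
          Max (F ! r ! c) < Min (F ! Suc r ! c))}"

definition semistandard_tableaux :: "nat list \<Rightarrow> nat list list set" where
  "semistandard_tableaux mu = {U. shape U = mu
     \<and> (\<forall>(r, c)\<in>diagram mu. 0 < U ! r ! c)
     \<and> (\<forall>r c c'. c < c' \<and> (r, c) \<in> diagram mu \<and> (r, c') \<in> diagram mu \<longrightarrow>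
          U ! r ! c \<le> U ! r ! c')
     \<and> (\<forall>r r' c. r < r' \<and> (r, c) \<in> diagram mu \<and> (r', c) \<in> diagram mu \<longrightarrow>
          U ! r ! c < U ! r' ! c)}"

text \<open>The upper bound on entries is \<open>r\<close> because list row \<open>r\<close> is row \<open>r + 1\<close>.\<close>

definition flagged_skew_fillings :: "nat list \<Rightarrow> nat list \<Rightarrow> (nat \<times> nat \<rightharpoonup> int) set" where
  "flagged_skew_fillings mu lam = {T. dom T = diagram mu - diagram lam
     \<and> (\<forall>r c c'. c < c' \<and> (r, c) \<in> dom T \<and> (r, c') \<in> dom T \<longrightarrow>
          the (T (r, c)) < the (T (r, c')))
     \<and> (\<forall>r r' c. r < r' \<and> (r, c) \<in> dom T \<and> (r', c) \<in> dom T \<longrightarrow>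
          the (T (r, c)) < the (T (r', c)))
     \<and> (\<forall>(r, c)\<in>dom T. 1 \<le> the (T (r, c)) \<and> the (T (r, c)) \<le> int r)}"

definition uncrowd_codomain :: "nat list \<Rightarrow> ((nat \<times> nat \<rightharpoonup> int) \<times> nat list list) set" where
  "uncrowd_codomain lam = {(T, U). \<exists>mu. is_partition mu \<and> diagram lam \<subseteq> diagram mu
     \<and> T \<in> flagged_skew_fillings mu lam \<and> U \<in> semistandard_tableaux mu}"

text \<open>Insertion into a single row; the first component is the entry bumped out, if any.\<close>

fun row_insert :: "nat \<Rightarrow> nat list \<Rightarrow> nat option \<times> nat list" where
  "row_insert x [] = (None, [x])"
| "row_insert x (y # ys) =
     (if x < y then (Some y, x # ys)
      else (case row_insert x ys of (b, zs) \<Rightarrow> (b, y # zs)))"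

text \<open>The second component of the result is the index of the row that received the new box.\<close>

fun rsk_insert :: "nat \<Rightarrow> nat list list \<Rightarrow> nat list list \<times> nat" where
  "rsk_insert x [] = ([[x]], 0)"
| "rsk_insert x (R # Rs) =
     (case row_insert x R of
        (None, R') \<Rightarrow> (R' # Rs, 0)
      | (Some y, R') \<Rightarrow> (case rsk_insert y Rs of (Rs', d) \<Rightarrow> (R' # Rs', Suc d)))"

type_synonym uncrowd_state = "(nat \<times> nat \<rightharpoonup> int) \<times> nat set list list"

text \<open>
  One removal of a largest entry from box \<open>(i, j)\<close>.  When it is performed, the boxes of the rows
  strictly below row \<open>i\<close> have all been processed already, so those rows hold singletons and are
  converted to an ordinary filling (and back) for the insertion.
\<close>

definition uncrowd_step :: "nat \<Rightarrow> nat \<Rightarrow> uncrowd_state \<Rightarrow> uncrowd_state" where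
  "uncrowd_step i j = (\<lambda>(T, U).
     let x = Max (U ! i ! j);
         (V, d) = rsk_insert x (map (map the_elem) (drop (Suc i) U));
         k = Suc i + d;
         upper = (take (Suc i) U)[i := (U ! i)[j := U ! i ! j - {x}]]
     in (T((k, length (V ! d) - 1) \<mapsto> int k - int i), upper @ map (map (\<lambda>y. {y})) V))"

definition uncrowd_box :: "nat \<times> nat \<Rightarrow> uncrowd_state \<Rightarrow> uncrowd_state" where
  "uncrowd_box = (\<lambda>(i, j). while (\<lambda>(T, U). 1 < card (U ! i ! j)) (uncrowd_step i j))"

text \<open>
  It suffices to list the boxes of the initial filling: boxes created during the process lie in
  rows that have already been read, and hold one entry each.
\<close>

definition reading_order :: "'a list list \<Rightarrow> (nat \<times> nat) list" where
  "reading_order F =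
     concat (map (\<lambda>i. map (\<lambda>j. (i, j)) (rev [0..<length (F ! i)])) (rev [0..<length F]))"

definition uncrowd :: "nat set list list \<Rightarrow> (nat \<times> nat \<rightharpoonup> int) \<times> nat list list" where
  "uncrowd F =
     (case fold uncrowd_box (reading_order F) (Map.empty, F) of
        (T, U) \<Rightarrow> (T, map (map the_elem) U))"

end

theory Submission
  imports Defs
begin

text \<open>
  Induction on the number of rows of the shape.  Uncrowding \<open>A # F\<close> first uncrowds \<open>F\<close> to
  \<open>(T, W)\<close> and then inserts into \<open>W\<close> the entries of \<open>A\<close> that are not minimal in their box;
  read from right to left these form a strictly decreasing list \<open>xs\<close>.  The row \<open>A\<close> is
  determined by its list \<open>a\<close> of minima and by \<open>xs\<close>, and the column condition between \<open>A\<close> and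
  the row below it becomes the relation \<open>fits\<close>.

  Inserting a decreasing list adds a vertical strip to the shape of \<open>W\<close>.  The new boxes carry the
  entry \<open>r\<close> in row \<open>r\<close>, the largest value allowed there, so the pair of the recorded filling and
  the new shape determines the old pair.  It remains to invert the insertion, given
  both shapes.  In a single row, bumping \<open>y\<close> by \<open>x\<close> turns a row that fits between its neighbours,
  with \<open>x\<close> fitting between it and the row above, into a row that fits between its neighbours,
  with \<open>y\<close> fitting between it and the row below; this is an equivalence, so the
  insertion can be undone row by row from the bottom.
\<close>

section \<open>Bumping in a single row\<close>

text \<open>The obstacle is that a row changes while a whole list is inserted into it, although
  \<open>fits\<close> tests every entry against one fixed row. Decrease resolves this: a bump
  exchanges two values that both exceed every entry still to come, and that are both less than every
  entry that must be tested again when working backwards. So each test may be made against the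
  initial or the final row, whichever is convenient. Decrease also bounds the growth: once an entry
  has been placed in a row, a smaller one always finds something to bump, so only the first entry of
  a list can be appended. This gives one new box per row at most, matching the strict rows of the
  recorded filling, where the largest allowed value occurs at most once per row. An entry
  \<open>k - i\<close> is a difference of row numbers. Putting a row on top leaves it unchanged but
  raises the bound for its box by one, so older entries always stay below the largest allowed
  value.\<close>

definition below :: "nat list \<Rightarrow> nat list \<Rightarrow> bool" where
  "below a R \<longleftrightarrow> length R \<le> length a \<and> (\<forall>j<length R. a ! j < R ! j)"

text \<open>An extra entry \<open>x\<close> of the box with minimum \<open>a ! p\<close> satisfies
  these inequalities in its own column. The column is quantified away because a bumped entry keeps
  no memory of its box; a missing entry of \<open>S\<close> counts as infinite.\<close>

definition fits :: "nat list \<Rightarrow> nat list \<Rightarrow> nat \<Rightarrow> bool" where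
  "fits a S x \<longleftrightarrow> (\<exists>p<length a. a ! p < x \<and> (p < length S \<longrightarrow> x < S ! p))"

text \<open>The form is symmetric under reversal: \<open>p\<close> is the leftmost position of
  \<open>R\<close> with an entry greater than \<open>x\<close>, and also the rightmost position of
  \<open>R'\<close> with an entry smaller than \<open>y\<close>. The same relation therefore
  describes insertion and reverse insertion.\<close>

definition bump :: "nat \<Rightarrow> nat list \<Rightarrow> nat \<Rightarrow> nat list \<Rightarrow> bool" where
  "bump x R y R' \<longleftrightarrow> x < y \<and> (\<exists>p<length R. R ! p = y \<and> R' = R[p := x]
     \<and> (\<forall>q<p. R ! q \<le> x) \<and> (\<forall>q<length R. p < q \<longrightarrow> y \<le> R ! q))"

lemma bump_position:
  assumes "bump x R y R'"
  shows "\<exists>p. x < y \<and> p < length R \<and> R ! p = y \<and> R' = R[p := x] \<and> R' ! p = x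
    \<and> R = R'[p := y] \<and> length R' = length R
    \<and> (\<forall>q. q < p \<longrightarrow> R ! q \<le> x) \<and> (\<forall>q. q < length R \<longrightarrow> p < q \<longrightarrow> y \<le> R ! q)
    \<and> (\<forall>q. q < length R \<longrightarrow> p < q \<longrightarrow> y \<le> R' ! q) \<and> (\<forall>q. q \<noteq> p \<longrightarrow> R' ! q = R ! q)"
proof -
  from assms obtain p where p: "x < y" "p < length R" "R ! p = y" "R' = R[p := x]"
    "\<forall>q<p. R ! q \<le> x" "\<forall>q<length R. p < q \<longrightarrow> y \<le> R ! q"
    unfolding bump_def by blast
  show ?thesis by (rule exI[of _ p]) (use p in auto)
qed

lemma bump_length: "bump x R y R' \<Longrightarrow> length R' = length R"
  by (auto simp: bump_def)

text \<open>Entries left of \<open>p\<close> are at most \<open>x < y\<close> and entries right of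
  \<open>p\<close> are at least \<open>y\<close>, so exchanging \<open>y\<close> and
  \<open>x\<close> at \<open>p\<close> alters no comparison.\<close>

lemma bump_sorted_iff:
  assumes "bump x R y R'"
  shows "sorted R' \<longleftrightarrow> sorted R"
proof -
  obtain p where p: "x < y" "p < length R" "R ! p = y" "R' = R[p := x]" "R' ! p = x"
    "length R' = length R"
    "\<And>q. q < p \<Longrightarrow> R ! q \<le> x" "\<And>q. q < length R \<Longrightarrow> p < q \<Longrightarrow> y \<le> R ! q"
    "\<And>q. q \<noteq> p \<Longrightarrow> R' ! q = R ! q"
    using bump_position[OF assms] by blast
  have "(R' ! i \<le> R' ! j) = (R ! i \<le> R ! j)" if "i < j" "j < length R" for i j
  proof -
    consider "i = p" | "j = p" | "i \<noteq> p" "j \<noteq> p" by blast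
    then show ?thesis
    proof cases
      case 1
      then have "y \<le> R ! j" "R' ! j = R ! j" using p that by auto
      then show ?thesis using 1 p by simp
    next
      case 2
      then have "R ! i \<le> x" "R' ! i = R ! i" using p that by auto
      then show ?thesis using 2 p by simp
    next
      case 3
      then show ?thesis using p by simp
    qed
  qed
  then show ?thesis using p(6) by (auto simp: sorted_wrt_iff_nth_less)
qed

text \<open>A column \<open>q\<close> in which \<open>x\<close> fits cannot lie left of the bumped
  column \<open>p\<close>, where all entries are at most \<open>x\<close>; hence
  \<open>a ! p \<le> a ! q < x\<close>. The bumped \<open>y\<close> fits below in column
  \<open>p\<close> itself, between \<open>x\<close> and \<open>S ! p\<close>.\<close>

lemma bump_forward:
  assumes "bump x R y R'" "sorted a" "below a R" "fits a R x" "below R S"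
  shows "below a R'" "below R' S" "fits R' S y"
proof -
  obtain p where p: "x < y" "p < length R" "R ! p = y" "R' = R[p := x]" "R' ! p = x"
    "length R' = length R" "\<And>q. q < p \<Longrightarrow> R ! q \<le> x" "\<And>q. q \<noteq> p \<Longrightarrow> R' ! q = R ! q"
    using bump_position[OF assms(1)] by blast
  obtain q where q: "q < length a" "a ! q < x" "q < length R \<longrightarrow> x < R ! q"
    using assms(4) by (auto simp: fits_def)
  have "p \<le> q" using p(2,7) q(3) by (metis leD leI le_less_trans less_imp_le_nat)
  then have "a ! p < x" using assms(2) q by (meson le_less_trans sorted_nth_mono)
  then show "below a R'" using assms(3) p unfolding below_def by metis
  show "below R' S" using assms(5) p unfolding below_def by (metis less_trans)
  show "fits R' S y" using assms(5) p by (auto simp: below_def fits_def)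
qed

text \<open>Mirror image of \<open>bump_forward\<close>: right of \<open>p\<close> all entries are
  at least \<open>y\<close>, so a column \<open>q\<close> in which \<open>y\<close> fits satisfies
  \<open>q \<le> p\<close>, and \<open>y < S ! q \<le> S ! p\<close>.\<close>

lemma bump_backward:
  assumes "bump x R y R'" "sorted S" "below a R'" "below R' S" "fits R' S y"
  shows "below a R" "below R S" "fits a R x"
proof -
  obtain p where p: "x < y" "p < length R" "R ! p = y" "R' = R[p := x]" "R' ! p = x"
    "length R' = length R" "\<And>q. q < length R \<Longrightarrow> p < q \<Longrightarrow> y \<le> R ! q" "\<And>q. q \<noteq> p \<Longrightarrow> R' ! q = R ! q"
    using bump_position[OF assms(1)] by blast
  obtain q where q: "q < length R'" "R' ! q < y" "q < length S \<longrightarrow> y < S ! q"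
    using assms(5) by (auto simp: fits_def)
  have "q \<le> p" using p q by (metis leD leI less_imp_neq)
  then have "y < S ! p" if "p < length S"
    using assms(2) q that by (meson le_less_trans less_le_trans sorted_nth_mono)
  then show "below R S" using assms(4) p unfolding below_def by metis
  show "below a R" using assms(3) p unfolding below_def by (metis less_trans)
  have "p < length a \<and> a ! p < R' ! p" using assms(3) p(2,6) unfolding below_def by simp
  then show "fits a R x" using p unfolding fits_def by (intro exI[of _ p]) simp
qed

text \<open>The exchanged values \<open>x\<close> and \<open>y\<close> both exceed
  \<open>x'\<close>. Entries inserted later in a decreasing list can thus be tested against the row
  as it was before.\<close>

lemma bump_fits_smaller:
  assumes "bump x R y R'" "x' < x"
  shows "fits a R' x' \<longleftrightarrow> fits a R x'"
proof -
  obtain p where p: "x < y" "p < length R" "R ! p = y" "R' ! p = x"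
    "length R' = length R" "\<And>q. q \<noteq> p \<Longrightarrow> R' ! q = R ! q"
    using bump_position[OF assms(1)] by blast
  have "x' < R' ! q \<longleftrightarrow> x' < R ! q" for q
    using p assms(2) by (cases "q = p") auto
  then show ?thesis using p by (simp add: fits_def)
qed

text \<open>Here both exchanged values are less than \<open>y'\<close>, so an entry bumped earlier
  may be tested against the row left by later bumps.\<close>

lemma bump_fits_larger:
  assumes "bump x R y R'" "y < y'"
  shows "fits R' S y' \<longleftrightarrow> fits R S y'"
proof -
  obtain p where p: "x < y" "p < length R" "R ! p = y" "R' ! p = x"
    "length R' = length R" "\<And>q. q \<noteq> p \<Longrightarrow> R' ! q = R ! q"
    using bump_position[OF assms(1)] by blast
  have "R' ! q < y' \<longleftrightarrow> R ! q < y'" for q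
    using p assms(2) by (cases "q = p") auto
  then show ?thesis using p by (simp add: fits_def)
qed

text \<open>\<open>R'\<close> and \<open>y\<close> determine \<open>p\<close> as the rightmost
  position with an entry smaller than \<open>y\<close>; then \<open>x\<close> is read off
  there.\<close>

lemma bump_inj:
  assumes "bump x R y R'" "bump z Q y R'"
  shows "x = z \<and> R = Q"
proof -
  obtain p where p: "x < y" "p < length R" "R = R'[p := y]" "R' ! p = x" "length R' = length R"
     "\<And>q. q < length R \<Longrightarrow> p < q \<Longrightarrow> y \<le> R' ! q"
    using bump_position[OF assms(1)] by blast
  obtain p' where p': "z < y" "p' < length Q" "Q = R'[p' := y]" "R' ! p' = z" "length R' = length Q"
     "\<And>q. q < length Q \<Longrightarrow> p' < q \<Longrightarrow> y \<le> R' ! q"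
    using bump_position[OF assms(2)] by blast
  have "p = p'" using p p' by (metis leD linorder_neqE_nat)
  then show ?thesis using p(3,4) p'(3,4) by metis
qed

lemma bump_reverse_exists:
  assumes "sorted R'" "p < length R'" "R' ! p < y"
  shows "\<exists>x R. bump x R y R'"
proof -
  define m where "m = Max {q. q < length R' \<and> R' ! q < y}"
  have fin: "finite {q. q < length R' \<and> R' ! q < y}" by simp
  have m: "m < length R'" "R' ! m < y"
    using Max_in[OF fin] assms(2,3) unfolding m_def by blast+
  have gt: "y \<le> R' ! q" if "q < length R'" "m < q" for q
    using that Max_ge[OF fin, of q] unfolding m_def[symmetric] by force
  have le: "R' ! q \<le> R' ! m" if "q < m" for q
    using assms(1) m(1) that by (simp add: sorted_nth_mono)
  have "bump (R' ! m) (R'[m := y]) y R'"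
    unfolding bump_def using m gt le by (auto intro!: exI[of _ m])
  then show ?thesis by blast
qed

lemma row_insert_max:
  "\<forall>z\<in>set R. z \<le> x \<Longrightarrow> row_insert x R = (None, R @ [x])"
  by (induction R) auto

lemma row_insert_leftmost:
  "p < length R \<Longrightarrow> x < R ! p \<Longrightarrow> \<forall>q<p. R ! q \<le> x \<Longrightarrow>
     row_insert x R = (Some (R ! p), R[p := x])"
proof (induction R arbitrary: p)
  case (Cons z R)
  show ?case
  proof (cases p)
    case (Suc p')
    have "row_insert x R = (Some (R ! p'), R[p' := x])"
      by (rule Cons.IH) (use Cons.prems Suc in fastforce)+
    moreover have "z \<le> x" using Cons.prems(3) Suc by force
    ultimately show ?thesis using Suc by simp
  qed (use Cons.prems in auto)
qed simp

lemma row_insert_bump: "bump x R y R' \<Longrightarrow> row_insert x R = (Some y, R')"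
  unfolding bump_def using row_insert_leftmost by blast

lemma bump_exists:
  assumes "sorted R" "z \<in> set R" "x < z"
  shows "\<exists>y R'. bump x R y R'"
proof -
  define p where "p = (LEAST q. q < length R \<and> x < R ! q)"
  have ex: "\<exists>q. q < length R \<and> x < R ! q" using assms by (metis in_set_conv_nth)
  have p: "p < length R \<and> x < R ! p"
    unfolding p_def by (rule LeastI_ex[OF ex])
  have "R ! q \<le> x" if "q < p" for q
    using not_less_Least[of q "\<lambda>q. q < length R \<and> x < R ! q"] that p unfolding p_def by auto
  then have "bump x R (R ! p) (R[p := x])"
    unfolding bump_def using p assms(1) by (auto intro!: exI[of _ p] simp: sorted_nth_mono)
  then show ?thesis by blast
qed

section \<open>Sequences of bumps in one row\<close>

abbreviation desc :: "nat list \<Rightarrow> bool" where "desc \<equiv> sorted_wrt (>)"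

text \<open>Covers only runs in which every inserted entry bumps another; appending is added in
  \<open>row_inserts_cases\<close>.\<close>

fun bumps :: "nat list \<Rightarrow> nat list \<Rightarrow> nat list \<Rightarrow> nat list \<Rightarrow> bool" where
  "bumps [] R [] R' \<longleftrightarrow> R' = R"
| "bumps (x # xs) R (y # ys) R' \<longleftrightarrow> (\<exists>R1. bump x R y R1 \<and> bumps xs R1 ys R')"
| "bumps _ _ _ _ \<longleftrightarrow> False"

lemma bumps_length: "bumps xs R ys R' \<Longrightarrow> length R' = length R"
  by (induction xs R ys R' rule: bumps.induct) (auto dest: bump_length)

lemma bumps_sorted_iff: "bumps xs R ys R' \<Longrightarrow> sorted R' \<longleftrightarrow> sorted R"
  by (induction xs R ys R' rule: bumps.induct) (auto dest: bump_sorted_iff)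

lemma bumps_fits_larger:
  "bumps xs R ys R' \<Longrightarrow> \<forall>y\<in>set ys. y < y' \<Longrightarrow> fits R' S y' \<longleftrightarrow> fits R S y'"
  by (induction xs R ys R' rule: bumps.induct) (auto dest: bump_fits_larger)

lemma bumps_inj:
  "bumps xs R ys R' \<Longrightarrow> bumps zs Q ys R' \<Longrightarrow> xs = zs \<and> R = Q"
proof (induction xs R ys R' arbitrary: zs Q rule: bumps.induct)
  case (1 R R')
  then show ?case by (cases zs) auto
next
  case (2 x xs R y ys R')
  then obtain R1 where R1: "bump x R y R1" "bumps xs R1 ys R'" by auto
  from 2(3) obtain z zs' where zs: "zs = z # zs'" by (cases zs) auto
  with 2(3) obtain Q1 where Q1: "bump z Q y Q1" "bumps zs' Q1 ys R'" by auto
  from 2(1)[OF R1(2) Q1(2)] have "xs = zs'" "R1 = Q1" by auto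
  with bump_inj[of x R y R1 z Q] R1 Q1 zs show ?case by auto
qed auto

text \<open>Position \<open>p\<close> now holds \<open>x > x'\<close>, so the second bump happens at
  some \<open>p' \<le> p\<close> and ejects an entry that is at most \<open>x\<close>, hence less
  than \<open>y\<close>.\<close>

lemma consecutive_bumps_decrease:
  assumes "bump x R y R1" "bump x' R1 y' R2" "x' < x" "sorted R1"
  shows "y' < y"
proof -
  obtain p where p: "x < y" "p < length R" "R1 ! p = x" "length R1 = length R"
    using bump_position[OF assms(1)] by blast
  obtain p' where p': "p' < length R1" "R1 ! p' = y'" "\<And>q. q < p' \<Longrightarrow> R1 ! q \<le> x'"
    using bump_position[OF assms(2)] by blast
  have "p' \<le> p" using p p' assms(3) by (metis leD leI)
  then show ?thesis using p p' assms(4) by (metis le_less_trans sorted_nth_mono)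
qed

text \<open>Right of \<open>p\<close> the entries are at least \<open>y > y'\<close>, so
  \<open>y'\<close> sits at some \<open>p' \<le> p\<close>; therefore
  \<open>x' < y' \<le> x\<close>.\<close>

lemma consecutive_unbumps_decrease:
  assumes "bump x R y R1" "bump x' R1 y' R2" "y' < y" "sorted R1"
  shows "x' < x"
proof -
  obtain p where p: "p < length R" "R1 ! p = x" "length R1 = length R"
     "\<And>q. q < length R \<Longrightarrow> p < q \<Longrightarrow> y \<le> R1 ! q"
    using bump_position[OF assms(1)] by blast
  obtain p' where p': "p' < length R1" "R1 ! p' = y'" "x' < y'"
    using bump_position[OF assms(2)] by blast
  have "p' \<le> p" using p p' assms(3) by (metis leD leI)
  then show ?thesis using p p' assms(4) by (metis less_le_trans sorted_nth_mono)
qed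

lemma bumps_forward:
  assumes "bumps xs R ys R'" "sorted a" "sorted R" "desc xs" "below a R" "below R S"
    "\<forall>x\<in>set xs. fits a R x"
  shows "below a R' \<and> below R' S \<and> desc ys \<and> (\<forall>y\<in>set ys. fits R' S y)"
  using assms
proof (induction xs R ys R' rule: bumps.induct)
  case (2 x xs R y ys R')
  then obtain R1 where R1: "bump x R y R1" "bumps xs R1 ys R'" by auto
  have s: "sorted R1" using R1 2 bump_sorted_iff by auto
  have fw: "below a R1" "below R1 S" "fits R1 S y"
    using bump_forward[OF R1(1)] 2 by auto
  have IH: "below a R' \<and> below R' S \<and> desc ys \<and> (\<forall>y\<in>set ys. fits R' S y)"
    by (rule 2(1)[OF R1(2)]) (use 2 s fw bump_fits_smaller[OF R1(1)] in auto)
  have lt: "\<forall>y'\<in>set ys. y' < y"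
  proof (cases ys)
    case (Cons y' ys')
    with R1(2) obtain x' xs' where xs: "xs = x' # xs'" by (cases xs) auto
    with R1(2) Cons obtain R2 where "bump x' R1 y' R2" by auto
    then have "y' < y" using consecutive_bumps_decrease[OF R1(1) _ _ s] 2 xs by auto
    then show ?thesis using IH Cons by auto
  qed simp
  \<comment> \<open>\<open>y\<close> fits relative to \<open>R1\<close>; all later bumped entries
    are smaller, so it fits relative to the final row too.\<close>
  then show ?case using IH bumps_fits_larger[OF R1(2)] fw by auto
qed auto

text \<open>The last bump is undone first, hence the induction handles the tail of \<open>ys\<close>
  before its head. The final conjunct is kept for \<open>row_inserts_backward\<close>: it shows that
  all of \<open>xs\<close> lies below the last entry of the sorted row, which may have to be taken
  off as an appended entry.\<close>

lemma bumps_backward: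
  assumes "sorted R'" "sorted S" "desc ys" "below a R'" "below R' S" "\<forall>y\<in>set ys. fits R' S y"
  shows "\<exists>xs R. bumps xs R ys R' \<and> below a R \<and> below R S \<and> desc xs \<and> (\<forall>x\<in>set xs. fits a R x)
    \<and> (\<forall>x\<in>set xs. \<exists>z\<in>set R. x < z)"
  using assms
proof (induction ys)
  case Nil
  then show ?case by (intro exI[of _ "[]"] exI[of _ R']) auto
next
  case (Cons y ys)
  then obtain xs R1 where IH: "bumps xs R1 ys R'" "below a R1" "below R1 S" "desc xs"
    "\<forall>x\<in>set xs. fits a R1 x" by auto
  have s: "sorted R1" using bumps_sorted_iff[OF IH(1)] Cons by auto
  have f: "fits R1 S y" using bumps_fits_larger[OF IH(1)] Cons by auto
  then obtain p where "p < length R1" "R1 ! p < y" by (auto simp: fits_def)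
  with bump_reverse_exists[OF s] obtain x R where b: "bump x R y R1" by metis
  have bw: "below a R" "below R S" "fits a R x"
    using bump_backward[OF b \<open>sorted S\<close>] IH f by auto
  have lt: "\<forall>x'\<in>set xs. x' < x"
  proof (cases xs)
    case (Cons x' xs')
    with IH(1) obtain y' ys' where ys: "ys = y' # ys'" by (cases ys) auto
    with IH(1) Cons obtain R2 where "bump x' R1 y' R2" by auto
    then have "x' < x" using consecutive_unbumps_decrease[OF b _ _ s] Cons.prems ys by auto
    then show ?thesis using IH(4) Cons by auto
  qed simp
  have "\<exists>z\<in>set R. x < z" using b by (auto simp: bump_def)
  moreover from this have "\<forall>x\<in>set xs. \<exists>z\<in>set R. x < z" using lt by (meson less_trans)
  ultimately show ?case using b IH bw lt bump_fits_smaller[OF b]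
    by (intro exI[of _ "x # xs"] exI[of _ R]) auto
qed

section \<open>Row insertion of a decreasing list, appending included\<close>

fun row_inserts :: "nat list \<Rightarrow> nat list \<Rightarrow> nat list \<times> nat list" where
  "row_inserts [] R = ([], R)"
| "row_inserts (x # xs) R = (case row_insert x R of (b, R1) \<Rightarrow>
     (case row_inserts xs R1 of (ys, R2) \<Rightarrow> (case b of None \<Rightarrow> ys | Some y \<Rightarrow> y # ys, R2)))"

lemma row_inserts_bumps: "bumps xs R ys R' \<Longrightarrow> row_inserts xs R = (ys, R')"
  by (induction xs R ys R' rule: bumps.induct) (auto simp: row_insert_bump)

lemma bumps_exists:
  "sorted R \<Longrightarrow> desc xs \<Longrightarrow> \<forall>x\<in>set xs. \<exists>z\<in>set R. x < z \<Longrightarrow> \<exists>ys R'. bumps xs R ys R'"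
proof (induction xs arbitrary: R)
  case Nil
  then show ?case by (intro exI[of _ "[]"] exI[of _ R]) simp
next
  case (Cons x xs)
  then obtain y R1 where b: "bump x R y R1" using bump_exists by (metis list.set_intros(1))
  \<comment> \<open>The entry just placed exceeds all remaining ones, so each of these will bump as
    well.\<close>
  have "x \<in> set R1" using b unfolding bump_def by (metis set_update_memI)
  then obtain ys R' where "bumps xs R1 ys R'"
    using Cons.IH[of R1] Cons.prems bump_sorted_iff[OF b] by auto
  with b show ?case by (intro exI[of _ "y # ys"] exI[of _ R']) auto
qed

text \<open>Only the head can be appended: after that it is itself an entry greater than all
  remaining ones, which therefore bump.\<close>

lemma row_inserts_cases:
  assumes "row_inserts xs R = (ys, R')" "sorted R" "desc xs"
  obtains (bumps) "bumps xs R ys R'"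
  | (append) x xs' where "xs = x # xs'" "\<forall>z\<in>set R. z \<le> x" "sorted (R @ [x])" "bumps xs' (R @ [x]) ys R'"
proof (cases "\<forall>x\<in>set xs. \<exists>z\<in>set R. x < z")
  case True
  with bumps_exists assms row_inserts_bumps show ?thesis by (metis prod.inject that(1))
next
  case False
  then obtain x xs' where xs: "xs = x # xs'" by (cases xs) auto
  have max: "\<forall>z\<in>set R. z \<le> x"
    using False assms(3) xs by auto (meson leD le_less_trans linorder_le_cases not_le)
  then have s: "sorted (R @ [x])" using assms(2) by (simp add: sorted_append)
  obtain zs Q where "bumps xs' (R @ [x]) zs Q"
    using bumps_exists[OF s, of xs'] assms(3) xs by auto
  moreover have "row_inserts xs' (R @ [x]) = (ys, R')"
    using assms(1) xs row_insert_max[OF max] by (auto split: prod.splits)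
  ultimately show ?thesis using that(2)[OF xs max s] row_inserts_bumps by fastforce
qed

text \<open>The appended box adds a condition in one column only, namely \<open>x' < x\<close>,
  which is given.\<close>

lemma fits_append_smaller: "x' < x \<Longrightarrow> fits a (R @ [x]) x' \<longleftrightarrow> fits a R x'"
  unfolding fits_def by (auto simp: nth_append less_Suc_eq)

text \<open>No entry of \<open>R\<close> exceeds \<open>x\<close>, so the column in which
  \<open>x\<close> fits lies beyond the end of \<open>R\<close>; the new box lies weakly left of it,
  under a smaller or equal entry of \<open>a\<close>.\<close>

lemma below_append_fits:
  assumes "sorted a" "below a R" "fits a R x" "\<forall>z\<in>set R. z \<le> x"
  shows "below a (R @ [x])"
proof -
  obtain q where q: "q < length a" "a ! q < x" "q < length R \<longrightarrow> x < R ! q"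
    using assms(3) by (auto simp: fits_def)
  then have "length R \<le> q" using assms(4) by (meson leD leI nth_mem)
  then have "length R < length a" "a ! length R < x"
    using q assms(1) by (auto dest: sorted_nth_mono[of a "length R" q])
  then show ?thesis using assms(2) by (auto simp: below_def nth_append less_Suc_eq)
qed

lemma row_inserts_forward:
  assumes "row_inserts xs R = (ys, R')" "sorted a" "sorted R" "desc xs" "below a R" "below R S"
    "\<forall>x\<in>set xs. fits a R x"
  shows "sorted R'" "below a R'" "below R' S" "desc ys" "\<forall>y\<in>set ys. fits R' S y"
    "length R' = length R \<or> length R' = Suc (length R)"
proof -
  have "sorted R' \<and> below a R' \<and> below R' S \<and> desc ys \<and> (\<forall>y\<in>set ys. fits R' S y)
      \<and> (length R' = length R \<or> length R' = Suc (length R))"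
    using assms(1,3,4)
  proof (cases rule: row_inserts_cases)
    case bumps
    then show ?thesis
      using bumps_forward[OF bumps assms(2-7)] assms(3) bumps_sorted_iff bumps_length by simp
  next
    case (append x xs')
    have "below a (R @ [x])" using below_append_fits assms append by auto
    moreover have "below (R @ [x]) S" using assms(6) by (auto simp: below_def nth_append)
    moreover have "\<forall>x'\<in>set xs'. fits a (R @ [x]) x'"
      using assms append fits_append_smaller by auto
    ultimately show ?thesis
      using bumps_forward[OF append(4) assms(2) append(3)] assms append
        bumps_sorted_iff[OF append(4)] bumps_length[OF append(4)] by auto
  qed
  then show "sorted R'" "below a R'" "below R' S" "desc ys" "\<forall>y\<in>set ys. fits R' S y"
    "length R' = length R \<or> length R' = Suc (length R)" by auto
qed

text \<open>The prescribed old length \<open>n\<close> decides whether the last entry, after all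
  bumps are undone, was appended and becomes the head of the inserted list.\<close>

lemma row_inserts_backward:
  assumes "sorted R'" "sorted S" "desc ys" "below a R'" "below R' S" "\<forall>y\<in>set ys. fits R' S y"
    "length R' = n \<or> length R' = Suc n" "length S \<le> n"
  obtains xs R where "row_inserts xs R = (ys, R')" "length R = n" "sorted R" "desc xs"
    "below a R" "below R S" "\<forall>x\<in>set xs. fits a R x"
proof -
  obtain xs R where b: "bumps xs R ys R'" "below a R" "below R S" "desc xs"
    "\<forall>x\<in>set xs. fits a R x" "\<forall>x\<in>set xs. \<exists>z\<in>set R. x < z"
    using bumps_backward[OF assms(1-6)] by blast
  have s: "sorted R" using bumps_sorted_iff[OF b(1)] assms(1) by simp
  have len: "length R = length R'" using bumps_length[OF b(1)] by simp
  show ?thesis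
  proof (cases "length R' = n")
    case True
    then show ?thesis using that[OF row_inserts_bumps[OF b(1)]] b s len by simp
  next
    case False
    then have "length R = Suc n" using len assms by auto
    then obtain Q x where Q: "R = Q @ [x]" "length Q = n" by (metis length_Suc_conv_rev)
    have max: "\<forall>z\<in>set Q. z \<le> x" using s Q by (simp add: sorted_append)
    have lt: "\<forall>x'\<in>set xs. x' < x" using b(6) max Q by (auto dest: less_le_trans)
    have "row_inserts (x # xs) Q = (ys, R')"
      using row_insert_max[OF max] row_inserts_bumps[OF b(1)] Q by simp
    moreover have bel: "length Q < length a" "\<forall>j<Suc (length Q). a ! j < (Q @ [x]) ! j"
      using b(2) Q by (auto simp: below_def)
    then have "below a Q" unfolding below_def by (auto simp: nth_append dest: less_SucI)
    moreover have "fits a Q x"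
      using bel unfolding fits_def by (intro exI[of _ "length Q"]) auto
    moreover have "below Q S"
      using b(3) Q assms(8) unfolding below_def by (auto simp: nth_append)
    moreover have "\<forall>x\<in>set xs. fits a Q x"
      using b(5) Q lt fits_append_smaller by auto
    ultimately show ?thesis using that[of "x # xs" Q] Q s b(4) lt by (auto simp: sorted_append)
  qed
qed

lemma row_inserts_inj:
  assumes "row_inserts xs R = (ys, R')" "sorted R" "desc xs"
    "row_inserts zs Q = (ys, R')" "sorted Q" "desc zs" "length R = length Q"
  shows "xs = zs \<and> R = Q"
  using assms(1-3)
proof (cases rule: row_inserts_cases)
  case 1: bumps
  show ?thesis using assms(4-6)
  proof (cases rule: row_inserts_cases)
    case bumps
    then show ?thesis using bumps_inj[OF 1] by blast
  next
    case (append z zs')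
    then show ?thesis using bumps_length[OF 1] bumps_length[OF append(4)] assms(7) by simp
  qed
next
  case 1: (append x xs')
  show ?thesis using assms(4-6)
  proof (cases rule: row_inserts_cases)
    case bumps
    then show ?thesis using bumps_length[OF 1(4)] bumps_length[OF bumps] assms(7) by simp
  next
    case (append z zs')
    then show ?thesis using bumps_inj[OF 1(4) append(4)] 1(1) by simp
  qed
qed

section \<open>Inserting decreasing lists and vertical strips\<close>

text \<open>Total in \<open>r\<close>, so that containment and strips can be stated for all rows
  although the two partitions may have different numbers of parts.\<close>

definition row_len :: "nat list \<Rightarrow> nat \<Rightarrow> nat" where
  "row_len mu r = (if r < length mu then mu ! r else 0)"

definition vertical_strip :: "nat list \<Rightarrow> nat list \<Rightarrow> bool" where
  "vertical_strip nu mu \<longleftrightarrow> (\<forall>r. row_len mu r = row_len nu r \<or> row_len mu r = Suc (row_len nu r))"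

definition top_row :: "'a list list \<Rightarrow> 'a list" where
  "top_row F = (case F of [] \<Rightarrow> [] | R # _ \<Rightarrow> R)"

lemma top_row_simps [simp]: "top_row [] = []" "top_row (R # F) = R"
  by (simp_all add: top_row_def)

lemma shape_simps [simp]: "shape [] = []" "shape (R # F) = length R # shape F"
  "length (shape F) = length F" "shape (tl F) = tl (shape F)"
  by (simp_all add: shape_def map_tl)

lemma row_len_Nil [simp]: "row_len [] r = 0"
  by (simp add: row_len_def)

lemma row_len_Cons [simp]: "row_len (m # mu) 0 = m" "row_len (m # mu) (Suc r) = row_len mu r"
  by (simp_all add: row_len_def)

lemma row_len_tl: "row_len (tl mu) r = row_len mu (Suc r)"
  by (cases mu) auto

lemma row_len_shape_0: "row_len (shape F) 0 = length (top_row F)"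
  by (cases F) auto

lemma diagram_row_len: "(r, c) \<in> diagram mu \<longleftrightarrow> c < row_len mu r"
  by (auto simp: diagram_def row_len_def)

lemma is_partition_Cons:
  "is_partition (m # mu) \<longleftrightarrow> 0 < m \<and> row_len mu 0 \<le> m \<and> is_partition mu"
proof (cases mu)
  case (Cons k ks)
  then show ?thesis by (auto simp: is_partition_def)
qed (simp add: is_partition_def)

lemma is_partition_Nil [simp]: "is_partition []"
  by (simp add: is_partition_def)

lemma is_partition_tl: "is_partition mu \<Longrightarrow> is_partition (tl mu)"
  by (cases mu) (auto simp: is_partition_Cons)

lemma row_len_antimono:
  "is_partition mu \<Longrightarrow> r \<le> r' \<Longrightarrow> row_len mu r' \<le> row_len mu r"
  unfolding is_partition_def row_len_def
  by (auto simp: sorted_wrt_iff_nth_less dest: le_neq_implies_less)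

lemma partition_eq_Nil: "is_partition mu \<Longrightarrow> row_len mu 0 = 0 \<Longrightarrow> mu = []"
  by (cases mu) (auto simp: is_partition_Cons)

lemma partition_eqI:
  "is_partition mu \<Longrightarrow> is_partition nu \<Longrightarrow> (\<And>r. row_len mu r = row_len nu r) \<Longrightarrow> mu = nu"
proof (induction mu arbitrary: nu)
  case Nil
  then show ?case using partition_eq_Nil by (metis row_len_Nil)
next
  case (Cons m mu)
  then obtain n nu' where nu: "nu = n # nu'"
    by (cases nu) (metis is_partition_Cons less_irrefl row_len_Cons(1) row_len_Nil)+
  have "mu = nu'"
    using Cons.IH Cons.prems nu by (metis is_partition_Cons row_len_Cons(2))
  then show ?case using Cons.prems(3)[of 0] nu by simp
qed

text \<open>Says that \<open>W\<close> could be the part of a semistandard tableau below the row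
  \<open>a\<close>; see \<open>sst_Cons\<close>.\<close>

fun under :: "nat list \<Rightarrow> nat list list \<Rightarrow> bool" where
  "under a [] \<longleftrightarrow> True"
| "under a (R # W) \<longleftrightarrow> sorted R \<and> R \<noteq> [] \<and> below a R \<and> under R W"

lemma below_Nil [simp]: "below a []"
  by (simp add: below_def)

lemma under_top_row:
  "under a W \<Longrightarrow> sorted (top_row W) \<and> below a (top_row W) \<and> under (top_row W) (tl W)"
  by (cases W) auto

lemma under_change: "under a W \<Longrightarrow> below b (top_row W) \<Longrightarrow> under b W"
  by (cases W) auto

lemma under_partition: "under a W \<Longrightarrow> is_partition (shape W) \<and> row_len (shape W) 0 \<le> length a"
  by (induction a W rule: under.induct) (auto simp: is_partition_Cons below_def)

section \<open>Insertion of a decreasing list into a tableau, row by row\<close>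

definition rsk_inserts :: "nat list \<Rightarrow> nat list list \<Rightarrow> nat list list" where
  "rsk_inserts xs W = fold (\<lambda>x W. fst (rsk_insert x W)) xs W"

text \<open>The algorithm inserts entry by entry, but a row depends only on the sequence of entries
  arriving at it. So the whole list may pass through the top row before anything enters the rows
  below.\<close>

lemma rsk_inserts_Cons:
  "row_inserts xs R = (ys, R') \<Longrightarrow> rsk_inserts xs (R # Rs) = R' # rsk_inserts ys Rs"
proof (induction xs arbitrary: R ys R' Rs)
  case (Cons x xs)
  obtain b R1 where b: "row_insert x R = (b, R1)" by fastforce
  obtain zs R2 where zs: "row_inserts xs R1 = (zs, R2)" by fastforce
  show ?case
  proof (cases b)
    case None
    then show ?thesis using Cons b zs by (simp add: rsk_inserts_def)
  next
    case (Some y)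
    then show ?thesis using Cons.IH[OF zs] Cons.prems b zs
      by (auto simp: rsk_inserts_def split: prod.splits)
  qed
qed (simp add: rsk_inserts_def)

lemma rsk_inserts_unfold:
  assumes "xs \<noteq> [] \<or> W \<noteq> []" "row_inserts xs (top_row W) = (ys, R')"
  shows "rsk_inserts xs W = R' # rsk_inserts ys (tl W)"
proof (cases W)
  case Nil
  then obtain x xs' where "xs = x # xs'" using assms(1) by (cases xs) auto
  \<comment> \<open>Inserting a first entry into no rows or into one empty row gives the same
    tableau, which makes \<open>top_row [] = []\<close> the right default.\<close>
  then have "rsk_inserts xs [] = rsk_inserts xs [[]]" by (simp add: rsk_inserts_def)
  then show ?thesis using rsk_inserts_Cons assms(2) Nil by simp
qed (use assms rsk_inserts_Cons in simp)

lemma rsk_inserts_eq_ConsE: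
  assumes "rsk_inserts xs W = R' # V"
  obtains ys where "row_inserts xs (top_row W) = (ys, R')" "rsk_inserts ys (tl W) = V"
    "xs \<noteq> [] \<or> W \<noteq> []"
proof -
  have ne: "xs \<noteq> [] \<or> W \<noteq> []" using assms by (auto simp: rsk_inserts_def)
  obtain ys Q where q: "row_inserts xs (top_row W) = (ys, Q)" by fastforce
  with rsk_inserts_unfold[OF ne q] assms have "Q = R'" "rsk_inserts ys (tl W) = V" by auto
  with that q ne show thesis by blast
qed

lemma rsk_inserts_eq_Nil: "rsk_inserts xs W = [] \<longleftrightarrow> xs = [] \<and> W = []"
proof
  assume V: "rsk_inserts xs W = []"
  obtain ys Q where "row_inserts xs (top_row W) = (ys, Q)" by fastforce
  with V rsk_inserts_unfold[of xs W] show "xs = [] \<and> W = []" by fastforce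
qed (simp add: rsk_inserts_def)

lemma row_insert_length:
  "row_insert x R = (b, R') \<Longrightarrow>
     R' \<noteq> [] \<and> length R' = (case b of None \<Rightarrow> Suc (length R) | Some _ \<Rightarrow> length R)"
  by (induction R arbitrary: R') (auto split: if_splits prod.splits option.splits)

lemma row_inserts_nonempty:
  "row_inserts xs R = (ys, R') \<Longrightarrow> xs \<noteq> [] \<or> R \<noteq> [] \<Longrightarrow> R' \<noteq> []"
proof (induction xs arbitrary: R ys R')
  case (Cons x xs)
  obtain b R1 where b: "row_insert x R = (b, R1)" by fastforce
  obtain zs R2 where zs: "row_inserts xs R1 = (zs, R2)" by fastforce
  show ?case using Cons.IH[OF zs] Cons.prems b zs row_insert_length[OF b] by simp
qed simp

definition insertable :: "nat list \<Rightarrow> nat list \<Rightarrow> nat list list \<Rightarrow> bool" where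
  "insertable a xs W \<longleftrightarrow> under a W \<and> desc xs \<and> (\<forall>x\<in>set xs. fits a (top_row W) x)"

lemma insertable_step:
  assumes "sorted a" "insertable a xs W" "row_inserts xs (top_row W) = (ys, R')"
    "xs \<noteq> [] \<or> W \<noteq> []"
  shows "sorted R'" "R' \<noteq> []" "below a R'" "insertable R' ys (tl W)"
    "length R' = length (top_row W) \<or> length R' = Suc (length (top_row W))"
proof -
  have u: "sorted (top_row W)" "below a (top_row W)" "under (top_row W) (tl W)"
    "desc xs" "\<forall>x\<in>set xs. fits a (top_row W) x"
    using assms(2) under_top_row by (auto simp: insertable_def)
  have S: "below (top_row W) (top_row (tl W))" using under_top_row[OF u(3)] by simp
  note fw = row_inserts_forward[OF assms(3,1) u(1,4,2) S u(5)]
  show "sorted R'" "below a R'"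
    "length R' = length (top_row W) \<or> length R' = Suc (length (top_row W))"
    by (rule fw)+
  show "insertable R' ys (tl W)"
    using fw under_change[OF u(3)] by (simp add: insertable_def)
  have "xs \<noteq> [] \<or> top_row W \<noteq> []" using assms(2,4) by (cases W) (auto simp: insertable_def)
  then show "R' \<noteq> []" using row_inserts_nonempty[OF assms(3)] by simp
qed

lemma rsk_inserts_forward:
  assumes "sorted a" "insertable a xs W"
  shows "under a (rsk_inserts xs W) \<and> vertical_strip (shape W) (shape (rsk_inserts xs W))"
  using assms
\<comment> \<open>The result loses exactly one row per step, whereas \<open>W\<close> may be
  exhausted while entries remain to be inserted.\<close>
proof (induction "rsk_inserts xs W" arbitrary: a xs W)
  case Nil
  then have "xs = [] \<and> W = []" using rsk_inserts_eq_Nil by metis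
  then show ?case by (simp add: rsk_inserts_def vertical_strip_def)
next
  case (Cons R' V)
  obtain ys where ys: "row_inserts xs (top_row W) = (ys, R')" "rsk_inserts ys (tl W) = V"
    "xs \<noteq> [] \<or> W \<noteq> []" using rsk_inserts_eq_ConsE[OF Cons(2)[symmetric]] .
  note st = insertable_step[OF Cons(3,4) ys(1,3)]
  have IH: "under R' V \<and> vertical_strip (shape (tl W)) (shape V)"
    using Cons(1)[OF ys(2)[symmetric] st(1,4)] ys(2) by simp
  have "vertical_strip (shape W) (shape (R' # V))"
    unfolding vertical_strip_def
  proof
    fix r
    show "row_len (shape (R' # V)) r = row_len (shape W) r \<or>
        row_len (shape (R' # V)) r = Suc (row_len (shape W) r)"
      using st(5) IH row_len_shape_0[of W]
      by (cases r) (auto simp: vertical_strip_def row_len_tl)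
  qed
  then show ?case using st IH Cons(2)[symmetric] by simp
qed

lemma rsk_inserts_inj:
  assumes "sorted a" "insertable a xs W" "insertable a zs Q"
    "rsk_inserts xs W = rsk_inserts zs Q" "shape W = shape Q"
  shows "xs = zs \<and> W = Q"
  using assms
proof (induction "rsk_inserts xs W" arbitrary: a xs W zs Q)
  case Nil
  then show ?case using rsk_inserts_eq_Nil by metis
next
  case (Cons R' V)
  obtain ys where ys: "row_inserts xs (top_row W) = (ys, R')" "rsk_inserts ys (tl W) = V"
    "xs \<noteq> [] \<or> W \<noteq> []" using rsk_inserts_eq_ConsE[OF Cons(2)[symmetric]] .
  obtain ys' where ys': "row_inserts zs (top_row Q) = (ys', R')" "rsk_inserts ys' (tl Q) = V"
    "zs \<noteq> [] \<or> Q \<noteq> []" using rsk_inserts_eq_ConsE[of zs Q R' V] Cons(2,6) by metis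
  note st = insertable_step[OF Cons(3,4) ys(1,3)]
  note st' = insertable_step[OF Cons(3,5) ys'(1,3)]
  \<comment> \<open>The lower rows come first: \<open>row_inserts_inj\<close> needs to know that
    both runs pass the same entries down.\<close>
  have eq: "ys = ys' \<and> tl W = tl Q"
    by (rule Cons(1)[OF ys(2)[symmetric] st(1,4) st'(4)]) (use ys ys' Cons(7) in auto)
  have len: "length (top_row W) = length (top_row Q)"
    using Cons(7) row_len_shape_0 by metis
  have "xs = zs \<and> top_row W = top_row Q"
    using row_inserts_inj[of xs "top_row W" ys R' zs "top_row Q"] eq ys ys' len Cons(4,5)
      under_top_row by (auto simp: insertable_def)
  moreover have "W = [] \<longleftrightarrow> Q = []" using Cons(7) by (cases W; cases Q) auto
  ultimately show ?case using eq by (cases W; cases Q) auto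
qed

lemma rsk_inserts_surj:
  assumes "under a V" "is_partition nu" "vertical_strip nu (shape V)"
  shows "\<exists>xs W. insertable a xs W \<and> shape W = nu \<and> rsk_inserts xs W = V"
  using assms
proof (induction V arbitrary: a nu)
  case Nil
  then have "nu = []"
    by (intro partition_eq_Nil) (auto simp: vertical_strip_def)
  then show ?case
    by (intro exI[of _ "[]"]) (auto simp: insertable_def rsk_inserts_def)
next
  case (Cons R' V)
  have strip: "vertical_strip (tl nu) (shape V)"
    using Cons.prems(3) unfolding vertical_strip_def row_len_tl by (metis row_len_Cons(2) shape_simps(2))
  have R': "sorted R'" "R' \<noteq> []" "below a R'" "under R' V" using Cons.prems(1) by auto
  obtain ys Rs where ys: "insertable R' ys Rs" "shape Rs = tl nu" "rsk_inserts ys Rs = V"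
    using Cons.IH[OF R'(4) is_partition_tl[OF Cons.prems(2)] strip] by blast
  let ?n = "row_len nu 0"
  have S: "sorted (top_row Rs)" "below R' (top_row Rs)" "under (top_row Rs) (tl Rs)"
    "desc ys" "\<forall>y\<in>set ys. fits R' (top_row Rs) y"
    using ys(1) under_top_row by (auto simp: insertable_def)
  have len: "length (top_row Rs) \<le> ?n"
    using ys(2) row_len_antimono[OF Cons.prems(2), of 0 1] row_len_shape_0[of Rs] row_len_tl[of nu 0]
    by simp
  have n: "length R' = ?n \<or> length R' = Suc ?n"
    using Cons.prems(3) unfolding vertical_strip_def by (metis row_len_Cons(1) shape_simps(2))
  obtain xs R where R: "row_inserts xs R = (ys, R')" "length R = ?n" "sorted R" "desc xs"
    "below a R" "below R (top_row Rs)" "\<forall>x\<in>set xs. fits a R x"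
    using row_inserts_backward[OF R'(1) S(1,4) R'(3) S(2,5) n len] by blast
  show ?case
  \<comment> \<open>If \<open>nu\<close> is empty, the top row was created by the insertion, and the
    preimage has to be \<open>[]\<close> rather than \<open>[[]]\<close>, since \<open>under\<close>
    admits no empty rows.\<close>
  proof (cases "nu = []")
    case True
    then have e: "R = []" "Rs = []" using R(2) ys(2) by (auto simp: shape_def)
    then have "xs \<noteq> []" using R(1) R'(2) by auto
    then have "rsk_inserts xs [] = R' # V"
      using rsk_inserts_unfold[of xs "[]"] R(1) e ys(3) by simp
    then show ?thesis using e R True
      by (intro exI[of _ xs] exI[of _ "[]"]) (auto simp: insertable_def)
  next
    case False
    then have "R \<noteq> []" using R(2) partition_eq_Nil[OF Cons.prems(2)] by auto
    moreover have "under R Rs" using R(6) ys(1) under_change by (auto simp: insertable_def)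
    moreover have "rsk_inserts xs (R # Rs) = R' # V"
      using rsk_inserts_unfold[of xs "R # Rs"] R(1) ys(3) by simp
    moreover have "shape (R # Rs) = nu" using R(2) ys(2) False by (cases nu) auto
    ultimately show ?thesis using R
      by (intro exI[of _ xs] exI[of _ "R # Rs"]) (auto simp: insertable_def)
  qed
qed

section \<open>Set-valued rows\<close>

definition set_row :: "nat set list \<Rightarrow> bool" where
  "set_row A \<longleftrightarrow> (\<forall>B\<in>set A. finite B \<and> B \<noteq> {}) \<and> sorted_wrt (\<lambda>B C. Max B \<le> Min C) A"

definition descending :: "nat set \<Rightarrow> nat list" where
  "descending X = rev (sorted_list_of_set X)"

text \<open>The entries are listed in the order in which the algorithm removes them.\<close>

definition extras :: "nat set list \<Rightarrow> nat list" where
  "extras A = concat (map (\<lambda>B. descending (B - {Min B})) (rev A))"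

lemma descending_props: "finite X \<Longrightarrow> set (descending X) = X \<and> desc (descending X)"
  by (simp add: descending_def sorted_wrt_rev)

lemma descending_set: "desc xs \<Longrightarrow> descending (set xs) = xs"
  by (metis List.finite_set descending_def descending_props rev_swap set_rev sorted_wrt_rev
      strict_sorted_equal)

lemma extras_Nil [simp]: "extras [] = []"
  by (simp add: extras_def)

lemma extras_Cons: "extras (B # A) = extras A @ descending (B - {Min B})"
  by (simp add: extras_def)

lemma set_extras:
  "set_row A \<Longrightarrow> set (extras A) = {x. \<exists>B\<in>set A. x \<in> B \<and> x \<noteq> Min B}"
  by (auto simp: extras_def set_row_def descending_props)

lemma set_row_Cons: "set_row (B # A) \<longleftrightarrow>
   finite B \<and> B \<noteq> {} \<and> (\<forall>C\<in>set A. Max B \<le> Min C) \<and> set_row A"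
  by (auto simp: set_row_def)

lemma less_extras:
  assumes "set_row A" "x \<in> set (extras A)" "\<forall>C\<in>set A. m \<le> Min C"
  shows "m < x"
proof -
  obtain C where "C \<in> set A" "x \<in> C" "x \<noteq> Min C" using set_extras assms by auto
  moreover have "Min C \<le> x" using calculation assms by (auto simp: set_row_def)
  ultimately show ?thesis using assms(3) by (metis le_neq_implies_less le_less_trans)
qed

text \<open>Boxes are only weakly separated, but the extras of a later box exceed its minimum
  strictly, hence also everything in an earlier box.\<close>

lemma desc_extras: "set_row A \<Longrightarrow> desc (extras A)"
proof (induction A)
  case (Cons B A)
  have "z < y" if "y \<in> set (extras A)" "z \<in> B" for y z
  proof -
    have "z \<le> Max B" using Cons.prems that by (simp add: set_row_Cons)
    also have "Max B < y" using less_extras that Cons.prems by (metis set_row_Cons)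
    finally show ?thesis .
  qed
  then show ?case using Cons by (auto simp: extras_Cons set_row_Cons sorted_wrt_append descending_props)
qed simp

lemma Min_le_Max: "finite B \<Longrightarrow> B \<noteq> {} \<Longrightarrow> Min B \<le> Max (B :: nat set)"
  by (meson Max_in Min_le)

lemma sorted_mins: "set_row A \<Longrightarrow> sorted (map Min A)"
  proof (induction A)
  case (Cons B A)
  have "Min B \<le> Max B" using Cons.prems by (simp add: set_row_Cons Min_le_Max)
  then have "\<forall>C\<in>set A. Min B \<le> Min C" using Cons.prems by (meson le_trans set_row_Cons)
  then show ?case using Cons by (simp add: set_row_Cons)
qed simp

text \<open>The minimum of the second box is a threshold: extras of the first box do not exceed it,
  all later extras do. This is how minima and extras together determine the row.\<close>

lemma extras_Cons_split:
  assumes "set_row (B # C # A)"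
  shows "extras (C # A) = filter (\<lambda>x. Min C < x) (extras (B # C # A))"
    "descending (B - {Min B}) = filter (\<lambda>x. \<not> Min C < x) (extras (B # C # A))"
proof -
  have C: "set_row (C # A)" "\<forall>D\<in>set (C # A). Min C \<le> Min D"
    using assms sorted_mins[of "C # A"] by (simp_all add: set_row_Cons del: Max_le_iff)
  have hi: "\<forall>x\<in>set (extras (C # A)). Min C < x" using less_extras[OF C(1) _ C(2)] by blast
  have lo: "\<forall>x\<in>set (descending (B - {Min B})). \<not> Min C < x"
  proof
    fix x assume "x \<in> set (descending (B - {Min B}))"
    then have "x \<le> Max B" using assms by (simp add: set_row_Cons descending_props)
    moreover have "Max B \<le> Min C" using assms by (simp add: set_row_Cons del: Max_le_iff)
    ultimately show "\<not> Min C < x" by simp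
  qed
  show "extras (C # A) = filter (\<lambda>x. Min C < x) (extras (B # C # A))"
    "descending (B - {Min B}) = filter (\<lambda>x. \<not> Min C < x) (extras (B # C # A))"
    using hi lo by (simp_all add: extras_Cons[of B] filter_id_conv filter_empty_conv)
qed

lemma set_row_eqI:
  "set_row A \<Longrightarrow> set_row A' \<Longrightarrow> map Min A = map Min A' \<Longrightarrow> extras A = extras A' \<Longrightarrow> A = A'"
proof (induction A arbitrary: A')
  case (Cons B A)
  then obtain B' D where A': "A' = B' # D" by (cases A') auto
  have ex: "extras A = extras D \<and> descending (B - {Min B}) = descending (B' - {Min B'})"
  proof (cases A)
    case Nil
    then show ?thesis using Cons.prems A' by (simp add: extras_Cons)
  next
    case A: (Cons C A2)
    then obtain C' D2 where "D = C' # D2" using Cons.prems(3) A' by (cases D) auto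
    then show ?thesis
      using A Cons.prems A' extras_Cons_split[of B C A2] extras_Cons_split[of B' C' D2] by simp
  qed
  have rows: "set_row A" "set_row D" "finite B" "B \<noteq> {}" "finite B'" "B' \<noteq> {}"
    using Cons.prems(1,2) unfolding A' set_row_Cons by blast+
  have AD: "A = D" by (rule Cons.IH) (use rows ex Cons.prems(3) A' in simp_all)
  have "B - {Min B} = B' - {Min B'}"
    using ex descending_props rows(3,5) by (metis finite_Diff)
  moreover have "Min B \<in> B" "Min B' \<in> B'" using Min_in rows by simp_all
  moreover have "Min B = Min B'" using Cons.prems(3) A' by simp
  ultimately have "B = B'" by (metis insert_Diff)
  then show ?case using AD A' by simp
qed simp

lemma desc_split: "desc xs \<Longrightarrow> xs = filter (\<lambda>x. h < x) xs @ filter (\<lambda>x. \<not> h < x) xs"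
  proof (induction xs)
  case (Cons x xs)
  then have "\<not> h < x \<Longrightarrow> filter (\<lambda>x. h < x) xs = []" by (auto simp: filter_empty_conv)
  then show ?case using Cons by (cases "h < x") auto
qed simp

text \<open>Each extra entry is put into the last box whose minimum it exceeds. Such a box exists
  because all extras exceed \<open>hd a\<close>.\<close>

lemma set_row_exists:
  assumes "sorted a" "desc xs" "xs \<noteq> [] \<longrightarrow> a \<noteq> []" "\<forall>x\<in>set xs. hd a < x"
  shows "\<exists>A. set_row A \<and> map Min A = a \<and> extras A = xs"
  using assms
proof (induction a arbitrary: xs)
  case Nil
  then show ?case by (intro exI[of _ "[]"]) (auto simp: set_row_def)
next
  case (Cons m a)
  define hi where "hi = (if a = [] then [] else filter (\<lambda>x. hd a < x) xs)"
  define lo where "lo = (if a = [] then xs else filter (\<lambda>x. \<not> hd a < x) xs)"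
  have xs: "xs = hi @ lo" using desc_split[OF Cons.prems(2)] by (simp add: hi_def lo_def)
  have d: "desc hi" "desc lo" using Cons.prems(2) xs by (auto simp: sorted_wrt_append)
  have "\<exists>A. set_row A \<and> map Min A = a \<and> extras A = hi"
    by (rule Cons.IH) (use Cons.prems d in \<open>auto simp: hi_def\<close>)
  then obtain A where A: "set_row A" "map Min A = a" "extras A = hi" by blast
  have m: "\<forall>x\<in>set lo. m < x" using Cons.prems xs by auto
  let ?B = "insert m (set lo)"
  have min: "Min ?B = m" using m by (intro Min_eqI) (auto intro: less_imp_le)
  have "?B - {m} = set lo" using m by auto
  then have ex: "extras (?B # A) = xs" using A xs d descending_set min by (simp add: extras_Cons)
  have "x \<le> Min C" if "x \<in> ?B" "C \<in> set A" for x C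
  proof -
    have "Min C \<in> set a" using A that by auto
    then have "hd a \<le> Min C" "a \<noteq> []" "m \<le> Min C"
      using Cons.prems(1) by (cases a; auto)+
    moreover have "x \<in> set lo \<Longrightarrow> x \<le> hd a" using calculation by (auto simp: lo_def)
    ultimately show ?thesis using that by auto
  qed
  then have "set_row (?B # A)" using A by (simp add: set_row_Cons del: Max_insert)
  then show ?case using ex A min by (intro exI[of _ "?B # A"]) simp
qed

text \<open>For the converse direction only the maximum of box \<open>j\<close> matters. If it is an
  extra, it fits in a column \<open>p\<close>, and \<open>p > j\<close> is impossible because minima
  to the right are at least that maximum; then \<open>S ! p \<le> S ! j\<close> finishes.\<close>

lemma set_row_above_iff:
  assumes "set_row A" "sorted S" "length S \<le> length A"
  shows "(\<forall>j<length S. Max (A ! j) < S ! j)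
    \<longleftrightarrow> below (map Min A) S \<and> (\<forall>x\<in>set (extras A). fits (map Min A) S x)" (is "?L \<longleftrightarrow> ?R")
proof
  have fin: "finite (A ! j)" "A ! j \<noteq> {}" if "j < length A" for j
    using assms(1) that by (auto simp: set_row_def)
  {
    assume L: ?L
    have "below (map Min A) S"
      unfolding below_def
    proof (intro conjI allI impI)
      fix j assume j: "j < length S"
      then have "Min (A ! j) \<le> Max (A ! j)" using fin assms(3) by (simp add: Min_le_Max)
      also have "\<dots> < S ! j" using L j by blast
      finally show "map Min A ! j < S ! j" using j assms(3) by simp
    qed (use assms(3) in simp)
    moreover have "fits (map Min A) S x" if x: "x \<in> set (extras A)" for x
    proof -
      obtain j where j: "j < length A" "x \<in> A ! j" "x \<noteq> Min (A ! j)"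
        using x set_extras[OF assms(1)] by (auto simp: in_set_conv_nth)
      have "Min (A ! j) \<le> x" using fin j by simp
      moreover have "x \<le> Max (A ! j)" using fin j by simp
      ultimately show ?thesis using L j
        unfolding fits_def by (intro exI[of _ j]) auto
    qed
    ultimately show ?R by blast
  }
  assume R: ?R
  show ?L
  proof (intro allI impI)
    fix j assume j: "j < length S"
    let ?x = "Max (A ! j)"
    have jA: "j < length A" using j assms(3) by simp
    show "?x < S ! j"
    proof (cases "?x = Min (A ! j)")
      case True
      then show ?thesis using R j jA by (auto simp: below_def)
    next
      case False
      then have "?x \<in> set (extras A)"
        using set_extras[OF assms(1)] fin[OF jA] jA Max_in[OF fin[OF jA]] nth_mem[OF jA] by blast
      then obtain p where p: "p < length A" "Min (A ! p) < ?x" "p < length S \<longrightarrow> ?x < S ! p"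
        using R by (auto simp: fits_def)
      have "p \<le> j"
      proof (rule ccontr)
        assume "\<not> p \<le> j"
        then have "?x \<le> Min (A ! p)"
          using assms(1) p(1) unfolding set_row_def sorted_wrt_iff_nth_less by (meson not_le)
        then show False using p(2) by simp
      qed
      then show ?thesis using p j assms(2) by (meson le_less_trans less_le_trans sorted_nth_mono)
    qed
  qed
qed

section \<open>Splitting off the first row\<close>

lemma all_nat_split: "(\<forall>r::nat. P r) \<longleftrightarrow> P 0 \<and> (\<forall>r. P (Suc r))"
  by (metis not0_implies_Suc)

text \<open>Neighbouring inequalities chain through \<open>Min \<le> Max\<close> because boxes are
  nonempty.\<close>

lemma set_row_adjacent:
  "set_row A \<longleftrightarrow> (\<forall>c<length A. finite (A ! c) \<and> A ! c \<noteq> {}) \<and>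
    (\<forall>c. Suc c < length A \<longrightarrow> Max (A ! c) \<le> Min (A ! Suc c))" (is "_ \<longleftrightarrow> ?R")
proof
  assume "set_row A"
  then show ?R unfolding set_row_def sorted_wrt_iff_nth_less by (meson lessI nth_mem)
next
  assume R: ?R
  have "Max (A ! i) \<le> Min (A ! j)" if "i < j" "j < length A" for i j
    using that
  proof (induction j)
    case (Suc j)
    have step: "Max (A ! j) \<le> Min (A ! Suc j)" using R Suc.prems by blast
    show ?case
    proof (cases "i = j")
      case False
      then have "Max (A ! i) \<le> Min (A ! j)" using Suc by simp
      also have "\<dots> \<le> Max (A ! j)" using R Suc.prems by (simp add: Min_le_Max)
      finally show ?thesis using step by (rule le_trans)
    qed (use step in simp)
  qed simp
  then show "set_row A"
    using R unfolding set_row_def sorted_wrt_iff_nth_less by (metis in_set_conv_nth)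
qed

section \<open>Both tableau conditions in terms of the top row and the rest\<close>

lemma svt_iff:
  assumes "is_partition lam"
  shows "F \<in> set_valued_tableaux lam \<longleftrightarrow> shape F = lam
     \<and> (\<forall>r c. c < row_len lam r \<longrightarrow> finite (F ! r ! c) \<and> F ! r ! c \<noteq> {} \<and> (\<forall>x\<in>F ! r ! c. 0 < x))
     \<and> (\<forall>r c. Suc c < row_len lam r \<longrightarrow> Max (F ! r ! c) \<le> Min (F ! r ! Suc c))
     \<and> (\<forall>r c. c < row_len lam (Suc r) \<longrightarrow> Max (F ! r ! c) < Min (F ! Suc r ! c))"
proof -
  have "(r, c) \<in> diagram lam \<and> (r, Suc c) \<in> diagram lam \<longleftrightarrow> Suc c < row_len lam r" for r c
    by (auto simp: diagram_row_len)
  moreover have "(r, c) \<in> diagram lam \<and> (Suc r, c) \<in> diagram lam \<longleftrightarrow> c < row_len lam (Suc r)" for r c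
    using row_len_antimono[OF assms, of r "Suc r"] by (auto simp: diagram_row_len)
  ultimately show ?thesis
    unfolding set_valued_tableaux_def mem_Collect_eq
    by (simp add: diagram_row_len split_paired_all Ball_def)
qed

lemma svt_Cons:
  assumes "is_partition (l # ls)"
  shows "A # F \<in> set_valued_tableaux (l # ls) \<longleftrightarrow>
    length A = l \<and> set_row A \<and> (\<forall>B\<in>set A. \<forall>x\<in>B. 0 < x) \<and> F \<in> set_valued_tableaux ls
    \<and> (\<forall>j<length (top_row F). Max (A ! j) < Min (top_row F ! j))"
proof -
  have p: "is_partition ls" using assms by (simp add: is_partition_Cons)
  have top: "(\<forall>c. c < row_len ls 0 \<longrightarrow> Max (A ! c) < Min (F ! 0 ! c)) \<longleftrightarrow>
     (\<forall>j<length (top_row F). Max (A ! j) < Min (top_row F ! j))" if "shape F = ls"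
    using that by (cases F) auto
  have pos: "(\<forall>B\<in>set A. \<forall>x\<in>B. 0 < x) \<longleftrightarrow> (\<forall>c<length A. \<forall>x\<in>A ! c. 0 < x)"
    by (metis in_set_conv_nth)
  let ?ok = "\<lambda>B. finite B \<and> B \<noteq> {} \<and> (\<forall>x\<in>B. 0 < x)"
  have boxes: "(\<forall>r c. c < row_len (l # ls) r \<longrightarrow> ?ok ((A # F) ! r ! c)) \<longleftrightarrow>
    (\<forall>c<l. ?ok (A ! c)) \<and> (\<forall>r c. c < row_len ls r \<longrightarrow> ?ok (F ! r ! c))"
    by (subst all_nat_split) simp
  have rows: "(\<forall>r c. Suc c < row_len (l # ls) r \<longrightarrow> Max ((A # F) ! r ! c) \<le> Min ((A # F) ! r ! Suc c))
    \<longleftrightarrow> (\<forall>c. Suc c < l \<longrightarrow> Max (A ! c) \<le> Min (A ! Suc c)) \<and>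
      (\<forall>r c. Suc c < row_len ls r \<longrightarrow> Max (F ! r ! c) \<le> Min (F ! r ! Suc c))"
    by (subst all_nat_split) (simp del: Max_le_iff)
  have cols: "(\<forall>r c. c < row_len (l # ls) (Suc r) \<longrightarrow> Max ((A # F) ! r ! c) < Min ((A # F) ! Suc r ! c))
    \<longleftrightarrow> (\<forall>c. c < row_len ls 0 \<longrightarrow> Max (A ! c) < Min (F ! 0 ! c)) \<and>
      (\<forall>r c. c < row_len ls (Suc r) \<longrightarrow> Max (F ! r ! c) < Min (F ! Suc r ! c))"
    by (subst all_nat_split) simp
  show ?thesis
    unfolding svt_iff[OF assms] svt_iff[OF p] set_row_adjacent pos boxes rows cols
    using top by auto
qed

lemma svt_Nil: "F \<in> set_valued_tableaux [] \<longleftrightarrow> F = []"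
  by (auto simp: svt_iff shape_def)

lemma sst_iff:
  assumes "is_partition mu"
  shows "U \<in> semistandard_tableaux mu \<longleftrightarrow> shape U = mu
     \<and> (\<forall>r c. c < row_len mu r \<longrightarrow> 0 < U ! r ! c)
     \<and> (\<forall>r c c'. c < c' \<longrightarrow> c' < row_len mu r \<longrightarrow> U ! r ! c \<le> U ! r ! c')
     \<and> (\<forall>r r' c. r < r' \<longrightarrow> c < row_len mu r' \<longrightarrow> U ! r ! c < U ! r' ! c)"
proof -
  have "c < c' \<and> (r, c) \<in> diagram mu \<and> (r, c') \<in> diagram mu \<longleftrightarrow> c < c' \<and> c' < row_len mu r" for r c c'
    by (auto simp: diagram_row_len)
  moreover have "r < r' \<and> (r, c) \<in> diagram mu \<and> (r', c) \<in> diagram mu \<longleftrightarrow> r < r' \<and> c < row_len mu r'"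
    for r r' c
    using row_len_antimono[OF assms, of r "r'"] by (auto simp: diagram_row_len)
  ultimately show ?thesis
    unfolding semistandard_tableaux_def mem_Collect_eq
    by (simp add: diagram_row_len split_paired_all Ball_def) blast
qed

lemma sorted_nth: "sorted R \<longleftrightarrow> (\<forall>c c'. c < c' \<longrightarrow> c' < length R \<longrightarrow> R ! c \<le> R ! c')"
  by (auto simp: sorted_wrt_iff_nth_less)

lemma under_iff:
  "is_partition (length a # shape V) \<Longrightarrow> under a V \<longleftrightarrow>
    (\<forall>r c c'. c < c' \<longrightarrow> c' < row_len (shape V) r \<longrightarrow> V ! r ! c \<le> V ! r ! c')
    \<and> (\<forall>r c. c < row_len (shape V) r \<longrightarrow> (a # V) ! r ! c < V ! r ! c)"
proof (induction V arbitrary: a)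
  case (Cons R V)
  have p: "is_partition (length R # shape V)" "length R \<le> length a" "R \<noteq> []"
    using Cons.prems by (auto simp: is_partition_Cons)
  have rows: "(\<forall>r c c'. c < c' \<longrightarrow> c' < row_len (shape (R # V)) r \<longrightarrow> (R # V) ! r ! c \<le> (R # V) ! r ! c')
    \<longleftrightarrow> sorted R \<and> (\<forall>r c c'. c < c' \<longrightarrow> c' < row_len (shape V) r \<longrightarrow> V ! r ! c \<le> V ! r ! c')"
    by (subst all_nat_split) (simp add: sorted_nth)
  have cols: "(\<forall>r c. c < row_len (shape (R # V)) r \<longrightarrow> (a # R # V) ! r ! c < (R # V) ! r ! c) \<longleftrightarrow>
    (\<forall>c<length R. a ! c < R ! c) \<and> (\<forall>r c. c < row_len (shape V) r \<longrightarrow> (R # V) ! r ! c < V ! r ! c)"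
    by (subst all_nat_split) simp
  show ?case
    unfolding under.simps Cons.IH[OF p(1)] below_def rows cols using p(2,3) by blast
qed simp

lemma adjacent_columns:
  assumes "is_partition mu" "\<forall>r c. c < row_len mu (Suc r) \<longrightarrow> U ! r ! c < (U ! Suc r ! c :: nat)"
  shows "r < r' \<Longrightarrow> c < row_len mu r' \<Longrightarrow> U ! r ! c < U ! r' ! c"
proof (induction r')
  case (Suc r')
  have step: "U ! r' ! c < U ! Suc r' ! c" using assms(2) Suc.prems by blast
  show ?case
  proof (cases "r = r'")
    case False
    then have "U ! r ! c < U ! r' ! c"
      using Suc row_len_antimono[OF assms(1), of r' "Suc r'"] by simp
    then show ?thesis using step by simp
  qed (use step in simp)
qed simp

lemma sst_Cons:
  assumes "is_partition (m # mu)"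
  shows "a # V \<in> semistandard_tableaux (m # mu) \<longleftrightarrow>
    length a = m \<and> shape V = mu \<and> sorted a \<and> (\<forall>x\<in>set a. 0 < x) \<and> under a V"
proof (cases "length a = m \<and> shape V = mu")
  case True
  then have p: "is_partition (length a # shape V)" using assms by simp
  let ?len = "row_len (m # mu)"
  have cols: "(\<forall>r r' c. r < r' \<longrightarrow> c < ?len r' \<longrightarrow> (a # V) ! r ! c < (a # V) ! r' ! c)
      \<longleftrightarrow> (\<forall>r c. c < row_len mu r \<longrightarrow> (a # V) ! r ! c < V ! r ! c)" (is "?L \<longleftrightarrow> ?R")
  proof
    assume ?L
    then have "c < ?len (Suc r) \<Longrightarrow> (a # V) ! r ! c < (a # V) ! Suc r ! c" for r c
      by blast
    then show ?R by simp
  next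
    assume ?R
    then have "\<forall>r c. c < ?len (Suc r) \<longrightarrow> (a # V) ! r ! c < (a # V) ! Suc r ! c" by simp
    from adjacent_columns[OF assms this] show ?L by blast
  qed
  \<comment> \<open>Below the top row positivity follows from strict columns, as an entry exceeding
    a natural number is positive.\<close>
  have pos: "(\<forall>r c. c < ?len r \<longrightarrow> 0 < (a # V) ! r ! c) \<longleftrightarrow> (\<forall>x\<in>set a. 0 < x)"
    if "\<forall>r r' c. r < r' \<longrightarrow> c < ?len r' \<longrightarrow> (a # V) ! r ! c < (a # V) ! r' ! c"
  proof -
    have "0 < (a # V) ! Suc r ! c" if "c < ?len (Suc r)" for r c
      using \<open>\<forall>r r' c. r < r' \<longrightarrow> c < ?len r' \<longrightarrow> (a # V) ! r ! c < (a # V) ! r' ! c\<close>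
        that by (metis gr_zeroI not_less_zero zero_less_Suc)
    moreover have "(\<forall>x\<in>set a. 0 < x) \<longleftrightarrow> (\<forall>c<m. 0 < a ! c)"
      using True by (metis in_set_conv_nth)
    ultimately show ?thesis by (subst all_nat_split) simp
  qed
  have rows: "(\<forall>r c c'. c < c' \<longrightarrow> c' < ?len r \<longrightarrow> (a # V) ! r ! c \<le> (a # V) ! r ! c') \<longleftrightarrow>
    sorted a \<and> (\<forall>r c c'. c < c' \<longrightarrow> c' < row_len mu r \<longrightarrow> V ! r ! c \<le> V ! r ! c')"
    using True by (subst all_nat_split) (simp add: sorted_nth)
  show ?thesis
    unfolding sst_iff[OF assms] under_iff[OF p] using True cols pos rows by auto
next
  case False
  then show ?thesis unfolding sst_iff[OF assms] by auto
qed

lemma sst_Nil: "U \<in> semistandard_tableaux [] \<longleftrightarrow> U = []"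
  by (auto simp: sst_iff shape_def)

section \<open>Flagged fillings and the boxes recorded for the top row\<close>

definition flagged :: "nat list \<Rightarrow> (nat \<times> nat \<rightharpoonup> int) \<Rightarrow> nat list \<Rightarrow> bool" where
  "flagged lam T mu \<longleftrightarrow> is_partition mu \<and> diagram lam \<subseteq> diagram mu \<and> T \<in> flagged_skew_fillings mu lam"

lemma uncrowd_codomain_iff:
  "(T, U) \<in> uncrowd_codomain lam \<longleftrightarrow> flagged lam T (shape U) \<and> U \<in> semistandard_tableaux (shape U)"
  by (auto simp: uncrowd_codomain_def flagged_def semistandard_tableaux_def)

lemma diagram_subset: "diagram lam \<subseteq> diagram mu \<longleftrightarrow> (\<forall>r. row_len lam r \<le> row_len mu r)"
proof
  assume "diagram lam \<subseteq> diagram mu"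
  then have "c < row_len lam r \<Longrightarrow> c < row_len mu r" for r c
    unfolding diagram_row_len[symmetric] by blast
  then show "\<forall>r. row_len lam r \<le> row_len mu r" by (meson not_le nless_le)
qed (metis diagram_row_len less_le_trans subrelI)

lemma flagged_iff:
  "flagged lam T mu \<longleftrightarrow> is_partition mu \<and> (\<forall>r. row_len lam r \<le> row_len mu r)
    \<and> (\<forall>r c. (\<exists>v. T (r, c) = Some v) \<longleftrightarrow> row_len lam r \<le> c \<and> c < row_len mu r)
    \<and> (\<forall>r c c' v v'. c < c' \<longrightarrow> T (r, c) = Some v \<longrightarrow> T (r, c') = Some v' \<longrightarrow> v < v')
    \<and> (\<forall>r r' c v v'. r < r' \<longrightarrow> T (r, c) = Some v \<longrightarrow> T (r', c) = Some v' \<longrightarrow> v < v')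
    \<and> (\<forall>r c v. T (r, c) = Some v \<longrightarrow> 1 \<le> v \<and> v \<le> int r)"
proof -
  have "dom T = diagram mu - diagram lam \<longleftrightarrow>
      (\<forall>r c. (\<exists>v. T (r, c) = Some v) \<longleftrightarrow> row_len lam r \<le> c \<and> c < row_len mu r)"
    unfolding set_eq_iff split_paired_All
    by (simp add: domIff diagram_row_len not_less conj_commute flip: not_None_eq)
  moreover have "(\<forall>(r, c)\<in>dom T. 1 \<le> the (T (r, c)) \<and> the (T (r, c)) \<le> int r)
     \<longleftrightarrow> (\<forall>r c v. T (r, c) = Some v \<longrightarrow> 1 \<le> v \<and> v \<le> int r)"
    by (simp add: Ball_def split_paired_All dom_def) (metis option.sel)
  moreover have "(\<forall>r c c'. c < c' \<and> (r, c) \<in> dom T \<and> (r, c') \<in> dom T \<longrightarrow>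
          the (T (r, c)) < the (T (r, c'))) \<longleftrightarrow>
     (\<forall>r c c' v v'. c < c' \<longrightarrow> T (r, c) = Some v \<longrightarrow> T (r, c') = Some v' \<longrightarrow> v < v')" by fastforce
  moreover have "(\<forall>r r' c. r < r' \<and> (r, c) \<in> dom T \<and> (r', c) \<in> dom T \<longrightarrow>
          the (T (r, c)) < the (T (r', c))) \<longleftrightarrow>
     (\<forall>r r' c v v'. r < r' \<longrightarrow> T (r, c) = Some v \<longrightarrow> T (r', c) = Some v' \<longrightarrow> v < v')" by fastforce
  ultimately show ?thesis
    unfolding flagged_def flagged_skew_fillings_def mem_Collect_eq diagram_subset by simp
qed

lemma flaggedD:
  assumes "flagged lam T mu"
  shows "is_partition mu" "\<And>r. row_len lam r \<le> row_len mu r"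
    "\<And>r c. (\<exists>v. T (r, c) = Some v) \<longleftrightarrow> row_len lam r \<le> c \<and> c < row_len mu r"
    "\<And>r c c' v v'. c < c' \<Longrightarrow> T (r, c) = Some v \<Longrightarrow> T (r, c') = Some v' \<Longrightarrow> v < v'"
    "\<And>r r' c v v'. r < r' \<Longrightarrow> T (r, c) = Some v \<Longrightarrow> T (r', c) = Some v' \<Longrightarrow> v < v'"
    "\<And>r c v. T (r, c) = Some v \<Longrightarrow> 1 \<le> v \<and> v \<le> int r"
proof -
  note 1 = assms[unfolded flagged_iff]
  note 2 = conjunct2[OF 1] and 3 = conjunct2[OF conjunct2[OF 1]]
  note 4 = conjunct2[OF 3] and 5 = conjunct2[OF conjunct2[OF 3]]
  show "is_partition mu" by (rule conjunct1[OF 1])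
  show "row_len lam r \<le> row_len mu r" for r using conjunct1[OF 2] by blast
  show "(\<exists>v. T (r, c) = Some v) \<longleftrightarrow> row_len lam r \<le> c \<and> c < row_len mu r" for r c
    using conjunct1[OF 3] by blast
  show "c < c' \<Longrightarrow> T (r, c) = Some v \<Longrightarrow> T (r, c') = Some v' \<Longrightarrow> v < v'" for r c c' v v'
    using conjunct1[OF 4] by blast
  show "r < r' \<Longrightarrow> T (r, c) = Some v \<Longrightarrow> T (r', c) = Some v' \<Longrightarrow> v < v'" for r r' c v v'
    using conjunct1[OF 5] by blast
  show "T (r, c) = Some v \<Longrightarrow> 1 \<le> v \<and> v \<le> int r" for r c v
    using conjunct2[OF 5] by blast
qed

text \<open>Boxes move down by one row while the entries, being differences of row numbers, stay the
  same.\<close>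

definition shift_filling :: "(nat \<times> nat \<rightharpoonup> int) \<Rightarrow> (nat \<times> nat \<rightharpoonup> int)" where
  "shift_filling T = (\<lambda>(r, c). case r of 0 \<Rightarrow> None | Suc r' \<Rightarrow> T (r', c))"

text \<open>\<open>nu\<close> and \<open>mu\<close> are shapes of the part below the top row, hence the index shift.\<close>

definition record_boxes ::
    "(nat \<times> nat \<rightharpoonup> int) \<Rightarrow> nat list \<Rightarrow> nat list \<Rightarrow> (nat \<times> nat \<rightharpoonup> int)" where
  "record_boxes T nu mu = (\<lambda>(r, c). if 0 < r \<and> row_len nu (r - 1) \<le> c \<and> c < row_len mu (r - 1)
     then Some (int r) else T (r, c))"

lemma record_shift_simps:
  "record_boxes (shift_filling T) nu mu (0, c) = None"
  "record_boxes (shift_filling T) nu mu (Suc r, c) =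
     (if row_len nu r \<le> c \<and> c < row_len mu r then Some (int (Suc r)) else T (r, c))"
  by (auto simp: record_boxes_def shift_filling_def)

text \<open>In row \<open>Suc d\<close> old entries are at most \<open>d\<close> and the new one is
  \<open>Suc d\<close>, placed at the right end. Below a new box a column contains only new boxes,
  because \<open>nu\<close> is a partition, and their entries grow with the row.\<close>

lemma flagged_record:
  assumes "flagged ls T nu" "is_partition (l # mu)" "vertical_strip nu mu"
  shows "flagged (l # ls) (record_boxes (shift_filling T) nu mu) (l # mu)"
proof -
  let ?T = "record_boxes (shift_filling T) nu mu"
  note nu = flaggedD(1)[OF assms(1)]
    and sub = flaggedD(2)[OF assms(1)]
    and dom = flaggedD(3)[OF assms(1)]
    and rows = flaggedD(4)[OF assms(1)]
    and cols = flaggedD(5)[OF assms(1)]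
    and bnd = flaggedD(6)[OF assms(1)]
  have strip: "row_len nu r \<le> row_len mu r" "row_len mu r \<le> Suc (row_len nu r)" for r
    using assms(3) unfolding vertical_strip_def by (metis le_refl le_SucI)+
  have E: "\<exists>d. r = Suc d \<and> (row_len nu d \<le> c \<and> c < row_len mu d \<and> v = int (Suc d)
      \<or> c < row_len nu d \<and> T (d, c) = Some v)" if "?T (r, c) = Some v" for r c v
    using that dom[of "r - 1" c] by (cases r) (auto simp: record_shift_simps split: if_splits)
  show ?thesis
    unfolding flagged_iff
  proof (intro conjI allI impI)
    show "is_partition (l # mu)" by (fact assms(2))
    show "row_len (l # ls) r \<le> row_len (l # mu) r" for r
      by (cases r) (auto intro: order_trans[OF sub strip(1)])
    show "(\<exists>v. ?T (r, c) = Some v) \<longleftrightarrow> row_len (l # ls) r \<le> c \<and> c < row_len (l # mu) r" for r c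
      by (cases r)
        (auto simp: record_shift_simps dom intro: order_trans[OF sub] less_le_trans[OF _ strip(1)])
    show "v < v'" if h: "c < c'" "?T (r, c) = Some v" "?T (r, c') = Some v'" for r c c' v v'
    proof -
      obtain d where d: "r = Suc d" "row_len nu d \<le> c \<and> c < row_len mu d \<and> v = int (Suc d)
        \<or> c < row_len nu d \<and> T (d, c) = Some v" using E[OF h(2)] by blast
      have d': "row_len nu d \<le> c' \<and> c' < row_len mu d \<and> v' = int (Suc d)
        \<or> c' < row_len nu d \<and> T (d, c') = Some v'" using E[OF h(3)] d(1) by blast
      show ?thesis using d(2) d' strip(2)[of d] h(1) rows[of c c' d v v'] bnd[of d c v] by auto
    qed
    show "v < v'" if h: "r < r'" "?T (r, c) = Some v" "?T (r', c) = Some v'" for r r' c v v'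
    proof -
      obtain d where d: "r = Suc d" "row_len nu d \<le> c \<and> c < row_len mu d \<and> v = int (Suc d)
        \<or> c < row_len nu d \<and> T (d, c) = Some v" using E[OF h(2)] by blast
      obtain d' where d': "r' = Suc d'" "row_len nu d' \<le> c \<and> c < row_len mu d' \<and> v' = int (Suc d')
        \<or> c < row_len nu d' \<and> T (d', c) = Some v'" using E[OF h(3)] by blast
      show ?thesis using d d' h(1) cols[of d d' c v v'] bnd[of d c v]
          row_len_antimono[OF nu, of d d'] by auto
    qed
    show "1 \<le> v" "v \<le> int r" if "?T (r, c) = Some v" for r c v
      using E[OF that] bnd by force+
  qed
qed

text \<open>An entry in row \<open>Suc r\<close> is old exactly if it is at most \<open>r\<close>.
  This recovers the old filling, and \<open>nu\<close> is \<open>ls\<close> together with its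
  domain.\<close>

lemma flagged_record_inj:
  assumes "flagged ls T nu" "flagged ls T' nu'" "vertical_strip nu mu" "vertical_strip nu' mu"
    "record_boxes (shift_filling T) nu mu = record_boxes (shift_filling T') nu' mu"
  shows "T = T' \<and> nu = nu'"
proof -
  have strip: "row_len nu r \<le> row_len mu r" "row_len nu' r \<le> row_len mu r" for r
    using assms(3,4) unfolding vertical_strip_def by (metis le_refl le_SucI)+
  have key: "T (r, c) = Some v \<longleftrightarrow>
      record_boxes (shift_filling T) nu mu (Suc r, c) = Some v \<and> v \<le> int r"
    if f: "flagged ls T nu" for T nu r c v
    using flaggedD(3)[OF f, of r c] flaggedD(6)[OF f, of r c v] by (auto simp: record_shift_simps)
  have "T (r, c) = Some v \<longleftrightarrow> T' (r, c) = Some v" for r c v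
    using key[OF assms(1)] key[OF assms(2)] assms(5) by simp
  then have T: "T = T'" by (intro ext) (metis option.exhaust surj_pair)
  have "row_len nu r = row_len nu' r" for r
  proof -
    have "c < row_len nu r \<longleftrightarrow> c < row_len nu' r" for c
      using flaggedD(2,3)[OF assms(1), of r] flaggedD(2,3)[OF assms(2), of r] T
      by (metis less_le_trans not_le)
    then show ?thesis by (metis linorder_neqE_nat nless_le)
  qed
  then show ?thesis using T partition_eqI flaggedD(1)[OF assms(1)] flaggedD(1)[OF assms(2)] by blast
qed

text \<open>Every row of \<open>D\<close> and its first column are finite initial segments of the
  naturals, hence given by their cardinalities, which serve as the parts and their number.\<close>

lemma order_ideal_partition:
  assumes fin: "finite D"
    and left: "\<And>r c c'. (r, c) \<in> D \<Longrightarrow> c' < c \<Longrightarrow> (r, c') \<in> D"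
    and up: "\<And>r c. (Suc r, c) \<in> D \<Longrightarrow> (r, c) \<in> D"
  obtains nu where "is_partition nu" "diagram nu = D"
proof -
  define len where "len r = card {c. (r, c) \<in> D}" for r
  define n where "n = card {r. (r, 0) \<in> D}"
  have initial: "A = {..<card A}" if "finite A" "\<And>x y. x \<in> A \<Longrightarrow> y < x \<Longrightarrow> y \<in> A" for A :: "nat set"
  proof (cases "A = {}")
    case False
    have "A = {..Max A}"
    proof (intro equalityI subsetI)
      fix x assume "x \<in> {..Max A}"
      then show "x \<in> A" using that(2)[of "Max A" x] Max_in[OF that(1) False] by (cases "x = Max A") auto
    qed (use that(1) in simp)
    then show ?thesis by (metis card_atMost lessThan_Suc_atMost)
  qed simp
  have "finite {c. (r, c) \<in> D}" for r
    by (rule finite_subset[OF _ finite_imageI[OF fin, of snd]]) force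
  then have row: "(r, c) \<in> D \<longleftrightarrow> c < len r" for r c
    using initial[of "{c. (r, c) \<in> D}"] left unfolding len_def by blast
  have up': "(r, c) \<in> D \<Longrightarrow> r' < r \<Longrightarrow> (r', c) \<in> D" for r r' c
    by (induction r) (use up less_Suc_eq in auto)
  have "finite {r. (r, 0) \<in> D}"
    by (rule finite_subset[OF _ finite_imageI[OF fin, of fst]]) force
  then have col: "(r, 0) \<in> D \<longleftrightarrow> r < n" for r
    using initial[of "{r. (r, 0) \<in> D}"] up' unfolding n_def by blast
  let ?nu = "map len [0..<n]"
  have "row_len ?nu r = len r" for r
    using row[of r 0] col[of r] by (auto simp: row_len_def)
  then have "diagram ?nu = D" using row by (auto simp: diagram_row_len)
  moreover have "is_partition ?nu"
    unfolding is_partition_def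
  proof
    have "len r' \<le> len r" if "r < r'" for r r'
      using up' row that by (meson not_le less_irrefl)
    then show "sorted_wrt (\<ge>) ?nu" by (auto simp: sorted_wrt_iff_nth_less)
    show "\<forall>p\<in>set ?nu. 0 < p" using row col by auto
  qed
  ultimately show thesis using that by blast
qed

text \<open>Discarding the entries of maximal value leaves an order ideal: one step up lowers the
  bound by one, but strict columns lower the entry by at least one. Strict rows allow one maximal
  entry per row, so what is discarded is a vertical strip.\<close>

lemma flagged_ConsE:
  assumes "is_partition (l # ls)" "flagged (l # ls) T mu'"
  obtains mu T' nu where "mu' = l # mu" "flagged ls T' nu" "vertical_strip nu mu"
    "T = record_boxes (shift_filling T') nu mu"
proof -
  note mu' = flaggedD(1)[OF assms(2)]
    and sub = flaggedD(2)[OF assms(2)]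
    and dom = flaggedD(3)[OF assms(2)]
    and rows = flaggedD(4)[OF assms(2)]
    and cols = flaggedD(5)[OF assms(2)]
    and bnd = flaggedD(6)[OF assms(2)]
  have ls: "is_partition ls" "0 < l" using assms(1) by (auto simp: is_partition_Cons)
  obtain m mu where mu: "mu' = m # mu" using sub[of 0] ls(2) by (cases mu') auto
  \<comment> \<open>In row 0 the bounds \<open>1 \<le> v \<le> 0\<close> are contradictory, so the
    top row of the outer shape has length \<open>l\<close>.\<close>
  have none0: "T (0, c) = None" for c
    using bnd[of 0 c] by (cases "T (0, c)") auto
  have m: "m = l" using dom[of 0 l] none0 sub[of 0] mu by auto
  have sub': "row_len ls r \<le> row_len mu r" for r using sub[of "Suc r"] mu by simp
  have dom': "(\<exists>v. T (Suc r, c) = Some v) \<longleftrightarrow> row_len ls r \<le> c \<and> c < row_len mu r" for r c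
    using dom[of "Suc r" c] mu by simp
  have pmu: "is_partition mu" using mu' mu by (simp add: is_partition_Cons)
  \<comment> \<open>The boxes added while the top row is processed are those whose entry equals their row index.\<close>
  define T' where "T' = (\<lambda>(r, c). case T (Suc r, c) of None \<Rightarrow> None
    | Some v \<Rightarrow> if v \<le> int r then Some v else None)"
  have T': "T' (r, c) = Some v \<longleftrightarrow> T (Suc r, c) = Some v \<and> v \<le> int r" for r c v
    by (auto simp: T'_def split: option.splits)
  define D where "D = diagram ls \<union> dom T'"
  have D: "(r, c) \<in> D \<longleftrightarrow> c < row_len ls r \<or> (\<exists>v. T (Suc r, c) = Some v \<and> v \<le> int r)" for r c
    unfolding D_def by (auto simp: diagram_row_len T')
  have Dmu: "D \<subseteq> diagram mu"
  proof (rule subrelI)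
    fix r c assume "(r, c) \<in> D"
    then show "(r, c) \<in> diagram mu"
      using dom'[of r c] sub'[of r] by (auto simp: D diagram_row_len)
  qed
  have "finite (diagram mu)"
    by (rule finite_subset[of _ "Sigma {..<length mu} (\<lambda>r. {..<mu ! r})"]) (auto simp: diagram_def)
  then have "finite D" using Dmu finite_subset by blast
  moreover have "(r, c') \<in> D" if h: "(r, c) \<in> D" "c' < c" for r c c'
  proof (cases "c' < row_len ls r")
    case False
    then obtain v where v: "T (Suc r, c) = Some v" "v \<le> int r" using h by (auto simp: D)
    then obtain v' where "T (Suc r, c') = Some v'" using False h(2) dom' by (meson less_trans not_le)
    then show ?thesis using rows[OF h(2)] v by (force simp: D)
  qed (simp add: D)
  moreover have "(r, c) \<in> D" if h: "(Suc r, c) \<in> D" for r c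
  proof (cases "c < row_len ls r")
    case False
    then have "\<not> c < row_len ls (Suc r)" using row_len_antimono[OF ls(1), of r "Suc r"] by simp
    then obtain v where v: "T (Suc (Suc r), c) = Some v" "v \<le> int (Suc r)" using h by (auto simp: D)
    then have "c < row_len mu r"
      using dom'[of "Suc r" c] row_len_antimono[OF pmu, of r "Suc r"] by auto
    then obtain v' where "T (Suc r, c) = Some v'" using False dom' by (meson not_le)
    then show ?thesis using cols[of "Suc r" "Suc (Suc r)" c v' v] v by (force simp: D)
  qed (simp add: D)
  ultimately obtain nu where nu: "is_partition nu" "diagram nu = D"
    using order_ideal_partition by metis
  have len: "c < row_len nu r \<longleftrightarrow> c < row_len ls r \<or> (\<exists>v. T (Suc r, c) = Some v \<and> v \<le> int r)" for r c
    using nu(2) D diagram_row_len by blast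
  have flag: "flagged ls T' nu"
    unfolding flagged_iff
  proof (intro conjI allI impI)
    show "is_partition nu" by (fact nu(1))
    show "row_len ls r \<le> row_len nu r" for r using len by (meson not_le less_irrefl)
    show "(\<exists>v. T' (r, c) = Some v) \<longleftrightarrow> row_len ls r \<le> c \<and> c < row_len nu r" for r c
      using len[of c r] dom'[of r c] T'[of r c] by (metis not_le)
    show "v < v'" if "c < c'" "T' (r, c) = Some v" "T' (r, c') = Some v'" for r c c' v v'
      using that rows T' by blast
    show "v < v'" if "r < r'" "T' (r, c) = Some v" "T' (r', c) = Some v'" for r r' c v v'
      using cols[of "Suc r" "Suc r'" c v v'] that(1) that(2,3)[unfolded T'] by simp
    show "1 \<le> v" "v \<le> int r" if "T' (r, c) = Some v" for r c v
      using that bnd T' by blast+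
  qed
  have new: "T (Suc r, c) = Some (int (Suc r))" if h: "row_len nu r \<le> c" "c < row_len mu r" for r c
  proof -
    have "\<not> c < row_len ls r" "\<not> (\<exists>v. T (Suc r, c) = Some v \<and> v \<le> int r)"
      using h(1) len[of c r] by auto
    moreover from this obtain v where "T (Suc r, c) = Some v" using dom' h(2) by (meson not_le)
    ultimately show ?thesis using bnd[of "Suc r" c v] by force
  qed
  have strip: "vertical_strip nu mu"
    unfolding vertical_strip_def
  proof
    fix r
    have "row_len nu r \<le> row_len mu r" using nu(2) Dmu diagram_subset by blast
    moreover have "row_len mu r \<le> Suc (row_len nu r)"
    proof (rule ccontr)
      assume "\<not> ?thesis"
      then have "T (Suc r, row_len nu r) = Some (int (Suc r))"
        "T (Suc r, Suc (row_len nu r)) = Some (int (Suc r))" using new by auto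
      then show False using rows by blast
    qed
    ultimately show "row_len mu r = row_len nu r \<or> row_len mu r = Suc (row_len nu r)" by linarith
  qed
  have "T (r, c) = record_boxes (shift_filling T') nu mu (r, c)" for r c
  proof (cases r)
    case (Suc d)
    show ?thesis
    proof (cases "row_len nu d \<le> c \<and> c < row_len mu d")
      case True
      then show ?thesis using new Suc by (simp add: record_shift_simps)
    next
      case False
      have "T (Suc d, c) = T' (d, c)"
      proof (cases "T (Suc d, c)")
        case None
        then show ?thesis by (simp add: T'_def)
      next
        case (Some v)
        then have "row_len ls d \<le> c" "c < row_len mu d" using dom' by blast+
        then have "v \<le> int d" using False len[of c d] Some by auto
        then show ?thesis using Some T'[of d c v] by simp
      qed
      then show ?thesis using False Suc by (auto simp: record_shift_simps)
    qed
  qed (simp add: none0 record_shift_simps)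
  then have "T = record_boxes (shift_filling T') nu mu" by (intro ext) (metis surj_pair)
  then show thesis using that flag strip mu m by blast
qed

section \<open>The algorithm, row by row\<close>

abbreviation singletons :: "nat list list \<Rightarrow> nat set list list" where
  "singletons \<equiv> map (map (\<lambda>y. {y}))"

definition prepend_row :: "nat set list \<Rightarrow> uncrowd_state \<Rightarrow> uncrowd_state" where
  "prepend_row A = (\<lambda>(T, U). (shift_filling T, A # U))"

lemma shift_filling_update: "shift_filling (T((k, c) \<mapsto> v)) = (shift_filling T)((Suc k, c) \<mapsto> v)"
  by (rule ext) (auto simp: shift_filling_def split: nat.splits if_splits)

text \<open>A step at row \<open>Suc i\<close> does not touch the top row, and in the recorded
  \<open>k - i\<close> both row numbers increase by one.\<close>

lemma uncrowd_step_prepend: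
  "uncrowd_step (Suc i) j (prepend_row A s) = prepend_row A (uncrowd_step i j s)"
  by (cases s) (auto simp: uncrowd_step_def prepend_row_def Let_def shift_filling_update split: prod.splits)

text \<open>Ensures that the boxes still to be read stay within range, as list access and update
  require.\<close>

definition grows :: "'a list list \<Rightarrow> 'b list list \<Rightarrow> bool" where
  "grows U U' \<longleftrightarrow> length U \<le> length U' \<and> (\<forall>r<length U. length (U ! r) \<le> length (U' ! r))"

lemma grows_refl: "grows U U"
  by (simp add: grows_def)

lemma grows_trans: "grows U V \<Longrightarrow> grows V W \<Longrightarrow> grows U W"
  unfolding grows_def by (meson le_trans less_le_trans)

lemma rsk_insert_shape:
  "rsk_insert x W = (V, d) \<Longrightarrow> d < length V \<and> length (V ! d) = Suc (row_len (shape W) d)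
    \<and> (\<forall>r. row_len (shape V) r = (if r = d then Suc (row_len (shape W) r) else row_len (shape W) r))
    \<and> grows W V"
proof (induction W arbitrary: x V d)
  case Nil
  then show ?case by (auto simp: row_len_def grows_def)
next
  case (Cons R W)
  obtain b R' where b: "row_insert x R = (b, R')" by fastforce
  show ?case
  proof (cases b)
    case None
    then have "length R' = Suc (length R)" "V = R' # W" "d = 0"
      using row_insert_length[OF b] Cons.prems b by auto
    then show ?thesis
      by (auto simp: row_len_def grows_def nth_Cons split: nat.splits)
  next
    case (Some y)
    obtain V' d' where V': "rsk_insert y W = (V', d')" by fastforce
    have e: "length R' = length R" "V = R' # V'" "d = Suc d'"
      using row_insert_length[OF b] Cons.prems b Some V' by auto
    note IH = Cons.IH[OF V']
    have "row_len (shape V) r = (if r = d then Suc (row_len (shape (R # W)) r) else row_len (shape (R # W)) r)" for r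
      using IH e by (cases r) auto
    moreover have "grows (R # W) V"
      using IH e by (auto simp: grows_def nth_Cons split: nat.splits)
    ultimately show ?thesis using IH e by simp
  qed
qed

lemma uncrowd_step_box:
  assumes "uncrowd_step i j (T, U) = (T', U')" "i < length U" "j < length (U ! i)"
  shows "U' ! i ! j = U ! i ! j - {Max (U ! i ! j)}" "grows U U'"
proof -
  let ?x = "Max (U ! i ! j)"
  obtain V d where V: "rsk_insert ?x (map (map the_elem) (drop (Suc i) U)) = (V, d)" by fastforce
  have U': "U' = (take (Suc i) U)[i := (U ! i)[j := U ! i ! j - {?x}]] @ singletons V"
    using assms(1) V by (simp add: uncrowd_step_def Let_def)
  show "U' ! i ! j = U ! i ! j - {?x}"
    using U' assms(2,3) by (simp add: nth_append)
  have "grows (map (map the_elem) (drop (Suc i) U)) V" using rsk_insert_shape[OF V] by blast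
  then have V': "length U - Suc i \<le> length V"
    "\<And>r. r < length U - Suc i \<Longrightarrow> length (U ! (Suc i + r)) \<le> length (V ! r)"
    using assms(2) by (auto simp: grows_def)
  show "grows U U'"
    unfolding grows_def
  proof (intro conjI allI impI)
    show "length U \<le> length U'" using U' V'(1) assms(2) by simp
    fix r assume r: "r < length U"
    show "length (U ! r) \<le> length (U' ! r)"
    proof (cases "r < Suc i")
      case True
      then show ?thesis using U' assms(2) r by (auto simp: nth_append nth_list_update)
    next
      case False
      then have "U' ! r = singletons V ! (r - Suc i)"
        using U' assms(2) r by (simp add: nth_append min_def)
      then show ?thesis using V'(2)[of "r - Suc i"] V'(1) False r by simp
    qed
  qed
qed

lemma uncrowd_box_unfold:
  "uncrowd_box (i, j) (T, U) =
     (if 1 < card (U ! i ! j) then uncrowd_box (i, j) (uncrowd_step i j (T, U)) else (T, U))"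
  unfolding uncrowd_box_def prod.case by (subst while_unfold) simp

text \<open>Both sides run the same loop; the range conditions guarantee that it terminates.\<close>

lemma uncrowd_box_prepend:
  "i < length U \<Longrightarrow> j < length (U ! i) \<Longrightarrow>
     uncrowd_box (Suc i, j) (prepend_row A (T, U)) = prepend_row A (uncrowd_box (i, j) (T, U))
     \<and> grows U (snd (uncrowd_box (i, j) (T, U)))"
proof (induction "card (U ! i ! j)" arbitrary: T U rule: less_induct)
  case less
  have p: "prepend_row A (T, U) = (shift_filling T, A # U)" by (simp add: prepend_row_def)
  show ?case
  proof (cases "1 < card (U ! i ! j)")
    case True
    obtain T' U' where s: "uncrowd_step i j (T, U) = (T', U')" by fastforce
    note box = uncrowd_step_box[OF s less.prems]
    have "finite (U ! i ! j)" using True by (metis card.infinite not_less_zero)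
    moreover have "U ! i ! j \<noteq> {}" using True by auto
    ultimately have card: "card (U' ! i ! j) < card (U ! i ! j)"
      using box(1) by (metis Max_in card_Diff1_less)
    have range: "i < length U'" "j < length (U' ! i)"
      using box(2) less.prems unfolding grows_def by (meson less_le_trans)+
    have IH: "uncrowd_box (Suc i, j) (prepend_row A (T', U')) = prepend_row A (uncrowd_box (i, j) (T', U'))
      \<and> grows U' (snd (uncrowd_box (i, j) (T', U')))" by (rule less.hyps[OF card range])
    have 1: "uncrowd_box (i, j) (T, U) = uncrowd_box (i, j) (T', U')"
      using True s by (subst uncrowd_box_unfold) simp
    have "uncrowd_step (Suc i) j (shift_filling T, A # U) = prepend_row A (T', U')"
      using uncrowd_step_prepend[of i j A "(T, U)"] s p by simp
    then have 2: "uncrowd_box (Suc i, j) (prepend_row A (T, U)) = uncrowd_box (Suc i, j) (prepend_row A (T', U'))"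
      unfolding p using True by (subst uncrowd_box_unfold) simp
    show ?thesis using 1 2 IH by (simp add: grows_trans[OF box(2)])
  next
    case False
    then have "uncrowd_box (i, j) (T, U) = (T, U)" by (subst uncrowd_box_unfold) simp
    moreover have "uncrowd_box (Suc i, j) (prepend_row A (T, U)) = prepend_row A (T, U)"
      unfolding p using False by (subst uncrowd_box_unfold) simp
    ultimately show ?thesis by (simp add: grows_refl)
  qed
qed

lemma fold_uncrowd_prepend:
  "\<forall>(i, j)\<in>set bs. i < length U \<and> j < length (U ! i) \<Longrightarrow>
     fold uncrowd_box (map (map_prod Suc id) bs) (prepend_row A (T, U)) =
     prepend_row A (fold uncrowd_box bs (T, U))"
proof (induction bs arbitrary: T U)
  case (Cons b bs)
  obtain i j where b: "b = (i, j)" by fastforce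
  obtain T' U' where s: "uncrowd_box (i, j) (T, U) = (T', U')" by fastforce
  have box: "uncrowd_box (Suc i, j) (prepend_row A (T, U)) = prepend_row A (T', U')" "grows U U'"
    using uncrowd_box_prepend[of i U j A T] Cons.prems b s by auto
  have "i' < length U' \<and> j' < length (U' ! i')" if "(i', j') \<in> set bs" for i' j'
  proof -
    have "i' < length U \<and> j' < length (U ! i')" using Cons.prems that by auto
    then show ?thesis using box(2) unfolding grows_def by (meson less_le_trans)
  qed
  then have "\<forall>(i, j)\<in>set bs. i < length U' \<and> j < length (U' ! i)" by auto
  from Cons.IH[OF this] show ?case using b box(1) s by simp
qed simp

lemma set_reading_order: "set (reading_order F) = {(i, j). i < length F \<and> j < length (F ! i)}"
  by (auto simp: reading_order_def)

lemma reading_order_Cons: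
  "reading_order (A # F) =
     map (map_prod Suc id) (reading_order F) @ map (Pair 0) (rev [0..<length A])"
proof -
  have "rev [0..<length (A # F)] = map Suc (rev [0..<length F]) @ [0]"
    by (simp add: upt_conv_Cons rev_map del: upt_Suc flip: map_Suc_upt)
  then show ?thesis
    by (simp add: reading_order_def map_concat comp_def del: upt_Suc)
qed

text \<open>For \<open>i = 0\<close> the recorded entry \<open>k - i\<close> is the row index
  itself, and the two shapes differ in exactly one box.\<close>

lemma uncrowd_step_top:
  assumes "j < length A" "x = Max (A ! j)" "rsk_insert x W = (V, d)"
  shows "uncrowd_step 0 j (T, A # singletons W) =
    (record_boxes T (shape W) (shape V), A[j := A ! j - {x}] # singletons V)"
proof -
  note sh = rsk_insert_shape[OF assms(3)]
  have iff: "row_len (shape W) e \<le> c \<and> c < row_len (shape V) e \<longleftrightarrow> e = d \<and> c = row_len (shape W) d"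
    for e c using sh by auto
  have "T((Suc d, length (V ! d) - 1) \<mapsto> int (Suc d)) = record_boxes T (shape W) (shape V)"
  proof
    fix b :: "nat \<times> nat"
    obtain r c where b: "b = (r, c)" by fastforce
    show "(T((Suc d, length (V ! d) - 1) \<mapsto> int (Suc d))) b = record_boxes T (shape W) (shape V) b"
      unfolding b record_boxes_def prod.case iff using sh by (cases r) auto
  qed
  then show ?thesis using assms
    by (simp add: uncrowd_step_def Let_def comp_def)
qed

lemma rsk_inserts_row_len: "row_len (shape W) r \<le> row_len (shape (rsk_inserts xs W)) r"
proof (induction xs arbitrary: W)
  case (Cons x xs)
  obtain V d where V: "rsk_insert x W = (V, d)" by fastforce
  then have "row_len (shape W) r \<le> row_len (shape V) r" using rsk_insert_shape[OF V] by auto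
  then show ?case using Cons[of V] V by (simp add: rsk_inserts_def)
qed (simp add: rsk_inserts_def)

lemma record_boxes_same: "record_boxes T nu nu = T"
  by (rule ext) (auto simp: record_boxes_def)

text \<open>The entry written depends only on the row of the box, not on when the box was added, so
  intermediate shapes can be forgotten.\<close>

lemma record_boxes_trans:
  assumes "\<And>r. row_len lam r \<le> row_len nu r" "\<And>r. row_len nu r \<le> row_len mu r"
  shows "record_boxes (record_boxes T lam nu) nu mu = record_boxes T lam mu"
proof
  fix b :: "nat \<times> nat"
  obtain r c where b: "b = (r, c)" by fastforce
  show "record_boxes (record_boxes T lam nu) nu mu b = record_boxes T lam mu b"
    unfolding b record_boxes_def using assms[of "r - 1"] by auto
qed

lemma rsk_inserts_append: "rsk_inserts (xs @ ys) W = rsk_inserts ys (rsk_inserts xs W)"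
  by (simp add: rsk_inserts_def)

lemma descending_Max:
  assumes "finite X" "X \<noteq> {}"
  shows "descending X = Max X # descending (X - {Max X})"
proof -
  have D: "set (descending (X - {Max X})) = X - {Max X}" "desc (descending (X - {Max X}))"
    using assms descending_props[of "X - {Max X}"] by simp_all
  moreover have "\<forall>y\<in>X - {Max X}. y < Max X"
    using assms by (metis DiffD1 DiffD2 Max_ge insertI1 nat_less_le)
  ultimately have "desc (Max X # descending (X - {Max X}))" by simp
  moreover have "set (Max X # descending (X - {Max X})) = X"
    using D(1) Max_in[OF assms] by (simp add: insert_absorb)
  ultimately show ?thesis using descending_set by metis
qed

text \<open>Each pass of the loop removes the head of the descending list of non-minimal entries. A
  box with two elements has its maximum different from its minimum, so the minimum survives.\<close>

lemma uncrowd_box_top: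
  assumes "j < length A" "finite (A ! j)" "A ! j \<noteq> {}"
    "V = rsk_inserts (descending (A ! j - {Min (A ! j)})) W"
  shows "uncrowd_box (0, j) (T, A # singletons W) =
    (record_boxes T (shape W) (shape V), A[j := {Min (A ! j)}] # singletons V)"
  using assms
proof (induction "card (A ! j)" arbitrary: A T W V rule: less_induct)
  case less
  let ?B = "A ! j" and ?x = "Max (A ! j)"
  show ?case
  proof (cases "1 < card ?B")
    case True
    obtain W' d where W': "rsk_insert ?x W = (W', d)" by fastforce
    let ?A = "A[j := ?B - {?x}]"
    have ne: "Min ?B \<noteq> ?x"
    proof
      assume "Min ?B = ?x"
      then have "?B \<subseteq> {?x}" using less.prems by (metis Max_ge Min_le antisym singletonI subsetI)
      then have "card ?B \<le> card {?x}" by (intro card_mono) auto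
      then show False using True by simp
    qed
    have B': "?A ! j = ?B - {?x}" "j < length ?A" "finite (?A ! j)" using less.prems by auto
    have min: "Min ?B \<in> ?B - {?x}" using less.prems ne by simp
    then have min': "Min (?A ! j) = Min ?B" using less.prems B' by (intro Min_eqI) auto
    have card: "card (?A ! j) < card ?B" using B' less.prems by (simp add: card_Diff1_less del: card_Diff_insert)
    have mem: "?x \<in> ?B - {Min ?B}"
      by (rule DiffI[OF Max_in[OF less.prems(2,3)]]) (use ne in simp)
    then have rest: "?B - {Min ?B} \<noteq> {}" by (metis empty_iff)
    have maxd: "Max (?B - {Min ?B}) = ?x"
    proof (rule Max_eqI)
      show "finite (?B - {Min ?B})" using less.prems(2) by simp
      show "?x \<in> ?B - {Min ?B}" by (rule mem)
      show "y \<le> ?x" if "y \<in> ?B - {Min ?B}" for y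
        by (rule Max_ge[OF less.prems(2) DiffD1[OF that]])
    qed
    have "descending (?B - {Min ?B}) = ?x # descending (?B - {Min ?B} - {?x})"
      using descending_Max[of "?B - {Min ?B}"] maxd less.prems(2) rest by simp
    moreover have "?B - {Min ?B} - {?x} = ?A ! j - {Min (?A ! j)}"
      by (subst min', subst B'(1)) blast
    ultimately have "descending (?B - {Min ?B}) = ?x # descending (?A ! j - {Min (?A ! j)})"
      by (simp only:)
    then have V: "V = rsk_inserts (descending (?A ! j - {Min (?A ! j)})) W'"
      using less.prems(4) W' by (simp add: rsk_inserts_def)
    have "uncrowd_box (0, j) (T, A # singletons W) =
        uncrowd_box (0, j) (record_boxes T (shape W) (shape W'), ?A # singletons W')"
      using True uncrowd_step_top[OF less.prems(1) refl W'] by (subst uncrowd_box_unfold) simp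
    also have "\<dots> = (record_boxes (record_boxes T (shape W) (shape W')) (shape W') (shape V),
        ?A[j := {Min (?A ! j)}] # singletons V)"
      by (rule less.hyps[OF card B'(2,3) _ V]) (use min B' in auto)
    also have "record_boxes (record_boxes T (shape W) (shape W')) (shape W') (shape V) =
        record_boxes T (shape W) (shape V)"
    proof (rule record_boxes_trans)
      show "row_len (shape W) r \<le> row_len (shape W') r" for r using rsk_insert_shape[OF W'] by simp
      show "row_len (shape W') r \<le> row_len (shape V) r" for r unfolding V by (rule rsk_inserts_row_len)
    qed
    finally show ?thesis unfolding min' by simp
  next
    case False
    then have "card ?B = 1" using less.prems by (metis One_nat_def card_gt_0_iff less_SucI linorder_neqE_nat not_less_eq less_one)
    then obtain m where m: "?B = {m}" by (auto simp: card_1_singleton_iff)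
    then have "V = W" using less.prems(4) by (simp add: descending_def rsk_inserts_def)
    moreover have "A[j := {Min ?B}] = A" using m by (metis Min_singleton list_update_id)
    moreover have "uncrowd_box (0, j) (T, A # singletons W) = (T, A # singletons W)"
      using False by (subst uncrowd_box_unfold) simp
    ultimately show ?thesis by (simp add: record_boxes_same)
  qed
qed

text \<open>Generalised to the first \<open>k\<close> boxes: reading goes from right to left, so the
  induction peels off box \<open>k\<close> first, with everything to its right already done.\<close>

lemma fold_uncrowd_top:
  assumes "\<forall>B\<in>set A. finite B \<and> B \<noteq> {}" "k \<le> length A" "V = rsk_inserts (extras (take k A)) W"
  shows "fold uncrowd_box (map (Pair 0) (rev [0..<k])) (T, A # singletons W) =
    (record_boxes T (shape W) (shape V), (map (\<lambda>B. {Min B}) (take k A) @ drop k A) # singletons V)"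
  using assms
proof (induction k arbitrary: A T W)
  case 0
  then show ?case by (simp add: rsk_inserts_def record_boxes_same)
next
  case (Suc k)
  let ?B = "A ! k" and ?A = "A[k := {Min (A ! k)}]"
  have k: "k < length A" using Suc.prems by simp
  have B: "finite ?B" "?B \<noteq> {}" using Suc.prems k by auto
  define W' where "W' = rsk_inserts (descending (?B - {Min ?B})) W"
  have V: "V = rsk_inserts (extras (take k ?A)) W'"
    using Suc.prems(3) k by (simp add: W'_def take_Suc_conv_app_nth extras_def rsk_inserts_append)
  have "fold uncrowd_box (map (Pair 0) (rev [0..<Suc k])) (T, A # singletons W) =
      fold uncrowd_box (map (Pair 0) (rev [0..<k])) (record_boxes T (shape W) (shape W'), ?A # singletons W')"
    using uncrowd_box_top[OF k B W'_def] by simp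
  also have "\<dots> = (record_boxes (record_boxes T (shape W) (shape W')) (shape W') (shape V),
      (map (\<lambda>B. {Min B}) (take k ?A) @ drop k ?A) # singletons V)"
    by (rule Suc.IH[OF _ _ V]) (use Suc.prems k in \<open>auto dest!: set_update_subset_insert[THEN subsetD]\<close>)
  also have "record_boxes (record_boxes T (shape W) (shape W')) (shape W') (shape V) =
      record_boxes T (shape W) (shape V)"
    unfolding V W'_def by (intro record_boxes_trans rsk_inserts_row_len)
  also have "map (\<lambda>B. {Min B}) (take k ?A) @ drop k ?A =
      map (\<lambda>B. {Min B}) (take (Suc k) A) @ drop (Suc k) A"
    using k by (simp add: take_Suc_conv_app_nth drop_update_swap Cons_nth_drop_Suc[symmetric])
  finally show ?case .
qed

fun uncrowd_rows :: "nat set list list \<Rightarrow> (nat \<times> nat \<rightharpoonup> int) \<times> nat list list" where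
  "uncrowd_rows [] = (Map.empty, [])"
| "uncrowd_rows (A # F) = (case uncrowd_rows F of (T, W) \<Rightarrow>
     let V = rsk_inserts (extras A) W
     in (record_boxes (shift_filling T) (shape W) (shape V), map Min A # V))"

lemma fold_uncrowd_rows:
  "\<forall>A\<in>set F. \<forall>B\<in>set A. finite B \<and> B \<noteq> {} \<Longrightarrow> uncrowd_rows F = (T, W) \<Longrightarrow>
     fold uncrowd_box (reading_order F) (Map.empty, F) = (T, singletons W)"
proof (induction F arbitrary: T W)
  case Nil
  then show ?case by (simp add: reading_order_def)
next
  case (Cons A F)
  obtain T' W' where r: "uncrowd_rows F = (T', W')" by fastforce
  define V where "V = rsk_inserts (extras A) W'"
  have TW: "T = record_boxes (shift_filling T') (shape W') (shape V)" "W = map Min A # V"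
    using Cons.prems(2) r by (auto simp: V_def Let_def)
  have start: "(Map.empty, A # F) = prepend_row A (Map.empty, F)"
    by (auto simp: prepend_row_def shift_filling_def split: nat.splits)
  have "fold uncrowd_box (map (map_prod Suc id) (reading_order F)) (Map.empty, A # F) =
      (shift_filling T', A # singletons W')"
    unfolding start using Cons.IH[OF _ r] Cons.prems(1)
    by (subst fold_uncrowd_prepend) (auto simp: set_reading_order prepend_row_def)
  then show ?case
    using fold_uncrowd_top[of A "length A" V W' "shift_filling T'"] Cons.prems(1) TW V_def
    by (simp add: reading_order_Cons comp_def del: upt_Suc)
qed

lemma uncrowd_eq_rows:
  "\<forall>A\<in>set F. \<forall>B\<in>set A. finite B \<and> B \<noteq> {} \<Longrightarrow> uncrowd F = uncrowd_rows F"
  using fold_uncrowd_rows[of F "fst (uncrowd_rows F)" "snd (uncrowd_rows F)"]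
  by (simp add: uncrowd_def comp_def)

section \<open>Bijectivity\<close>

lemma sst_under:
  "is_partition (shape W) \<Longrightarrow> W \<in> semistandard_tableaux (shape W) \<Longrightarrow> below a (top_row W) \<Longrightarrow> under a W"
  by (cases W) (auto simp: sst_Cons is_partition_Cons)

lemma under_sst:
  assumes "under a W"
  shows "W \<in> semistandard_tableaux (shape W)"
proof (cases W)
  case (Cons R W')
  have p: "is_partition (shape (R # W'))" using under_partition[OF assms] Cons by simp
  have "0 < x" if "x \<in> set R" for x
    using assms Cons that by (auto simp: below_def in_set_conv_nth)
  then show ?thesis using assms Cons p sst_Cons[of "length R" "shape W'" R W'] by simp
qed (simp add: sst_Nil)

lemma svt_finite:
  "is_partition lam \<Longrightarrow> F \<in> set_valued_tableaux lam \<Longrightarrow> \<forall>A\<in>set F. \<forall>B\<in>set A. finite B \<and> B \<noteq> {}"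
proof (induction lam arbitrary: F)
  case (Cons l ls)
  then obtain A F' where F: "F = A # F'" by (cases F) (auto simp: svt_iff shape_def)
  then have "F' \<in> set_valued_tableaux ls" "set_row A" "is_partition ls"
    using Cons.prems F by (simp_all add: svt_Cons is_partition_Cons)
  then show ?case using Cons.IH F unfolding set_row_def by (metis set_ConsD)
qed (simp add: svt_Nil)

lemma svt_ConsE:
  assumes "is_partition (l # ls)" "F \<in> set_valued_tableaux (l # ls)"
  obtains A F' where "F = A # F'" "length A = l" "set_row A" "\<forall>B\<in>set A. \<forall>x\<in>B. 0 < x"
    "F' \<in> set_valued_tableaux ls" "\<forall>j<length (top_row F'). Max (A ! j) < Min (top_row F' ! j)"
proof -
  obtain A F' where F: "F = A # F'"
    using assms by (cases F) (auto simp: svt_iff shape_def)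
  show thesis using that[OF F] assms svt_Cons[OF assms(1)] unfolding F by blast
qed

text \<open>Carried along in the induction because the column condition on \<open>F\<close> speaks
  of minima in its top row, while insertion sees the top row of the uncrowded tableau.\<close>

definition mins_on_top :: "nat set list list \<Rightarrow> bool" where
  "mins_on_top F \<longleftrightarrow> top_row (snd (uncrowd_rows F)) = map Min (top_row F)"

lemma svt_shape: "is_partition lam \<Longrightarrow> F \<in> set_valued_tableaux lam \<Longrightarrow> shape F = lam"
  by (simp add: svt_iff)

text \<open>An equivalence, because it serves twice: left to right it makes the insertion theory
  applicable, right to left it shows that a reconstructed row may be placed on top of
  \<open>F\<close>.\<close>

lemma svt_insertable:
  assumes "is_partition (l # ls)" "F \<in> set_valued_tableaux ls" "mins_on_top F"
    "uncrowd_rows F = (T, W)" "(T, W) \<in> uncrowd_codomain ls" "length A = l" "set_row A"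
  shows "(\<forall>j<length (top_row F). Max (A ! j) < Min (top_row F ! j)) \<longleftrightarrow>
    insertable (map Min A) (extras A) W"
proof -
  have W: "is_partition (shape W)" "W \<in> semistandard_tableaux (shape W)"
    using assms(5) by (auto simp: uncrowd_codomain_iff flagged_def)
  have top: "top_row W = map Min (top_row F)" using assms(3,4) by (simp add: mins_on_top_def)
  have sorted: "sorted (top_row W)"
    using W by (cases W) (auto simp: sst_Cons)
  have p: "is_partition ls" "row_len ls 0 \<le> l" using assms(1) by (auto simp: is_partition_Cons)
  have "length (top_row W) \<le> length A"
    using top svt_shape[OF p(1) assms(2)] p(2) assms(6) row_len_shape_0[of F] by simp
  note above = set_row_above_iff[OF assms(7) sorted this]
  have under: "under (map Min A) W \<longleftrightarrow> below (map Min A) (top_row W)"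
    using sst_under[OF W] under_top_row by blast
  have "(\<forall>j<length (top_row F). Max (A ! j) < Min (top_row F ! j)) \<longleftrightarrow>
      (\<forall>j<length (top_row W). Max (A ! j) < top_row W ! j)"
    unfolding top by (metis length_map nth_map)
  then show ?thesis
    unfolding above insertable_def under using desc_extras[OF assms(7)] by blast
qed

lemma uncrowd_rows_Cons:
  "uncrowd_rows F = (T, W) \<Longrightarrow> uncrowd_rows (A # F) =
    (record_boxes (shift_filling T) (shape W) (shape (rsk_inserts (extras A) W)),
     map Min A # rsk_inserts (extras A) W)"
  by (simp add: Let_def)

lemma uncrowd_rows_bij:
  "is_partition lam \<Longrightarrow>
    (\<forall>F\<in>set_valued_tableaux lam. uncrowd_rows F \<in> uncrowd_codomain lam \<and> mins_on_top F)
    \<and> inj_on uncrowd_rows (set_valued_tableaux lam)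
    \<and> uncrowd_codomain lam \<subseteq> uncrowd_rows ` set_valued_tableaux lam"
proof (induction lam)
  case Nil
  \<comment> \<open>For the empty shape a nonempty outer shape would need an entry in row 0, where
    none is allowed.\<close>
  have "(T, U) \<in> uncrowd_codomain [] \<longleftrightarrow> T = Map.empty \<and> U = []" for T U
  proof
    assume L: "(T, U) \<in> uncrowd_codomain []"
    then have fl: "flagged [] T (shape U)" by (simp add: uncrowd_codomain_iff)
    note fD = flaggedD[OF fl]
    have "T (0, c) = None" for c using fD(6)[of 0 c] by (cases "T (0, c)") auto
    then have "row_len (shape U) 0 = 0" using fD(3)[of 0 0] by auto
    then have "shape U = []" using partition_eq_Nil fD(1) by blast
    then have "U = []" by (simp add: shape_def)
    then have "T (r, c) = None" for r c using fD(3)[of r c] by (cases "T (r, c)") auto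
    then show "T = Map.empty \<and> U = []" using \<open>U = []\<close> by auto
  next
    assume "T = Map.empty \<and> U = []"
    then show "(T, U) \<in> uncrowd_codomain []"
      by (simp add: uncrowd_codomain_iff sst_Nil flagged_iff)
  qed
  moreover have "set_valued_tableaux [] = {[]}" using svt_Nil by blast
  ultimately show ?case by (auto simp: mins_on_top_def)
next
  case (Cons l ls)
  have p: "is_partition ls" "0 < l" using Cons.prems by (auto simp: is_partition_Cons)
  note IH = Cons.IH[OF p(1)]
  have rows: "\<exists>T W. uncrowd_rows F = (T, W) \<and> (T, W) \<in> uncrowd_codomain ls \<and> flagged ls T (shape W)
      \<and> insertable (map Min A) (extras A) W \<and> sorted (map Min A)"
    if "F \<in> set_valued_tableaux ls" "length A = l" "set_row A"
      "\<forall>j<length (top_row F). Max (A ! j) < Min (top_row F ! j)" for A F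
  proof -
    obtain T W where TW: "uncrowd_rows F = (T, W)" by fastforce
    have L: "(T, W) \<in> uncrowd_codomain ls" "mins_on_top F" using IH that(1) TW by force+
    then show ?thesis
      using TW svt_insertable[OF Cons.prems that(1) L(2) TW L(1) that(2,3)] that(3,4) sorted_mins
      by (auto simp: uncrowd_codomain_iff)
  qed
  show ?case
  proof (intro conjI ballI)
    fix F assume "F \<in> set_valued_tableaux (l # ls)"
    then obtain A F' where F: "F = A # F'" "length A = l" "set_row A" "\<forall>B\<in>set A. \<forall>x\<in>B. 0 < x"
      "F' \<in> set_valued_tableaux ls" "\<forall>j<length (top_row F'). Max (A ! j) < Min (top_row F' ! j)"
      using svt_ConsE[OF Cons.prems] by blast
    obtain T W where TW: "uncrowd_rows F' = (T, W)" "flagged ls T (shape W)"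
      "insertable (map Min A) (extras A) W" "sorted (map Min A)"
      using rows[OF F(5,2,3,6)] by blast
    let ?V = "rsk_inserts (extras A) W"
    have V: "under (map Min A) ?V" "vertical_strip (shape W) (shape ?V)"
      using rsk_inserts_forward[OF TW(4,3)] by auto
    have part: "is_partition (l # shape ?V)"
      using under_partition[OF V(1)] p(2) F(2) by (simp add: is_partition_Cons)
    have "\<forall>x\<in>set (map Min A). 0 < x" using F(3,4) by (auto simp: set_row_def)
    then have "map Min A # ?V \<in> semistandard_tableaux (l # shape ?V)"
      using sst_Cons[OF part] V(1) TW(4) F(2) by simp
    moreover have "flagged (l # ls) (record_boxes (shift_filling T) (shape W) (shape ?V)) (l # shape ?V)"
      by (rule flagged_record[OF TW(2) part V(2)])
    ultimately show "uncrowd_rows F \<in> uncrowd_codomain (l # ls)"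
      unfolding F(1) uncrowd_rows_Cons[OF TW(1)] by (simp add: uncrowd_codomain_iff F(2))
    show "mins_on_top F"
      unfolding mins_on_top_def F(1) uncrowd_rows_Cons[OF TW(1)] by simp
  next
    show "inj_on uncrowd_rows (set_valued_tableaux (l # ls))"
    proof (rule inj_onI)
      fix F G assume FG: "F \<in> set_valued_tableaux (l # ls)" "G \<in> set_valued_tableaux (l # ls)"
        "uncrowd_rows F = uncrowd_rows G"
      obtain A F' where F: "F = A # F'" "length A = l" "set_row A"
        "F' \<in> set_valued_tableaux ls" "\<forall>j<length (top_row F'). Max (A ! j) < Min (top_row F' ! j)"
        using svt_ConsE[OF Cons.prems FG(1)] by blast
      obtain B G' where G: "G = B # G'" "length B = l" "set_row B"
        "G' \<in> set_valued_tableaux ls" "\<forall>j<length (top_row G'). Max (B ! j) < Min (top_row G' ! j)"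
        using svt_ConsE[OF Cons.prems FG(2)] by blast
      obtain T W where TW: "uncrowd_rows F' = (T, W)" "flagged ls T (shape W)"
        "insertable (map Min A) (extras A) W" "sorted (map Min A)"
        using rows[OF F(4,2,3,5)] by blast
      obtain T2 W2 where TW2: "uncrowd_rows G' = (T2, W2)" "flagged ls T2 (shape W2)"
        "insertable (map Min B) (extras B) W2" "sorted (map Min B)"
        using rows[OF G(4,2,3,5)] by blast
      let ?V = "rsk_inserts (extras A) W"
      have eq: "map Min A = map Min B" "?V = rsk_inserts (extras B) W2"
        "record_boxes (shift_filling T) (shape W) (shape ?V) =
          record_boxes (shift_filling T2) (shape W2) (shape ?V)"
        using FG(3) unfolding F(1) G(1) uncrowd_rows_Cons[OF TW(1)] uncrowd_rows_Cons[OF TW2(1)]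
        by auto
      have strips: "vertical_strip (shape W) (shape ?V)" "vertical_strip (shape W2) (shape ?V)"
        using rsk_inserts_forward[OF TW(4,3)] rsk_inserts_forward[OF TW2(4,3)] eq(2) by auto
      \<comment> \<open>The fillings are compared before the tableaux: undoing the insertion
        requires the old shapes to agree.\<close>
      have T: "T = T2" "shape W = shape W2"
        using flagged_record_inj[OF TW(2) TW2(2) strips eq(3)] by auto
      have "extras A = extras B" "W = W2"
        using rsk_inserts_inj[OF TW(4,3) TW2(3)[folded eq(1)] eq(2) T(2)] by auto
      then have "A = B" "uncrowd_rows F' = uncrowd_rows G'"
        using set_row_eqI[OF F(3) G(3) eq(1)] TW(1) TW2(1) T(1) by auto
      then show "F = G" using IH F(1,4) G(1,4) by (auto dest: inj_onD)
    qed
  next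
    show "uncrowd_codomain (l # ls) \<subseteq> uncrowd_rows ` set_valued_tableaux (l # ls)"
    proof (rule subrelI)
      fix T U assume L: "(T, U) \<in> uncrowd_codomain (l # ls)"
      then have fl: "flagged (l # ls) T (shape U)" and U: "U \<in> semistandard_tableaux (shape U)"
        by (auto simp: uncrowd_codomain_iff)
      obtain mu T' nu where mu: "shape U = l # mu" "flagged ls T' nu" "vertical_strip nu mu"
        "T = record_boxes (shift_filling T') nu mu" using flagged_ConsE[OF Cons.prems fl] .
      obtain a V where aV: "U = a # V" "shape V = mu" using mu(1) by (cases U) auto
      have part: "is_partition (l # mu)" using flaggedD(1)[OF fl] mu(1) by simp
      have a: "length a = l" "sorted a" "\<forall>x\<in>set a. 0 < x" "under a V"
        using U sst_Cons[OF part, of a V] mu(1) aV by auto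
      obtain xs W where W: "insertable a xs W" "shape W = nu" "rsk_inserts xs W = V"
        using rsk_inserts_surj[OF a(4) flaggedD(1)[OF mu(2)]] mu(3) aV(2) by blast
      have "(T', W) \<in> uncrowd_codomain ls"
        using mu(2) W(1,2) under_sst by (auto simp: uncrowd_codomain_iff insertable_def)
      then obtain F where F: "F \<in> set_valued_tableaux ls" "uncrowd_rows F = (T', W)"
        using IH by (metis (no_types, lifting) imageE subsetD)
      \<comment> \<open>Fitting gives some column \<open>q\<close> with \<open>a ! q < x\<close>,
        and the first entry of the sorted row is at most \<open>a ! q\<close>; so every extra finds
        a box in \<open>set_row_exists\<close>.\<close>
      have "hd a < x" if x: "x \<in> set xs" for x
      proof -
        obtain q where "q < length a" "a ! q < x"
          using W(1) x by (auto simp: insertable_def fits_def)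
        then show ?thesis using sorted_nth_mono[OF a(2), of 0 q] by (cases a) auto
      qed
      then obtain A where A: "set_row A" "map Min A = a" "extras A = xs"
        using set_row_exists[OF a(2), of xs] W(1) a(1) p(2) by (auto simp: insertable_def)
      have len: "length A = l" using A(2) a(1) by auto
      have "\<forall>j<length (top_row F). Max (A ! j) < Min (top_row F ! j)"
        using svt_insertable[OF Cons.prems F(1) _ F(2) \<open>(T', W) \<in> uncrowd_codomain ls\<close> len A(1)]
          IH F(1) W(1) A by blast
      moreover have "0 < x" if "B \<in> set A" "x \<in> B" for B x
      proof -
        have "finite B" using A(1) that(1) by (simp add: set_row_def)
        then have "Min B \<le> x" using that(2) by simp
        moreover have "0 < Min B" using that(1) A(2) a(3) by auto
        ultimately show ?thesis by simp
      qed
      ultimately have "A # F \<in> set_valued_tableaux (l # ls)"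
        using svt_Cons[OF Cons.prems] A(1) len F(1) by blast
      moreover have "uncrowd_rows (A # F) = (T, U)"
        unfolding uncrowd_rows_Cons[OF F(2)] using A W aV mu(4) by simp
      ultimately show "(T, U) \<in> uncrowd_rows ` set_valued_tableaux (l # ls)"
        by (metis image_eqI)
    qed
  qed
qed

theorem theorem4p4:
  fixes lam :: "nat list"
  assumes "is_partition lam"
  shows "bij_betw uncrowd (set_valued_tableaux lam) (uncrowd_codomain lam)"
proof -
  have "bij_betw uncrowd_rows (set_valued_tableaux lam) (uncrowd_codomain lam)"
    using uncrowd_rows_bij[OF assms] unfolding bij_betw_def by blast
  moreover have "uncrowd F = uncrowd_rows F" if "F \<in> set_valued_tableaux lam" for F
    using uncrowd_eq_rows svt_finite[OF assms that] by blast
  ultimately show ?thesis using bij_betw_cong by metis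
qed

end
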